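(* Let $S=(S_{ij})$ be a real symmetric positive definite matrix of size $d$. Write $I_d$ for the identity matrix of size $d$ and $Z=\mathrm{Diag}(S_{ii})$ for the diagonal part of $S$. Assume $Z<I_d$ and $Z+S<2I_d$. Set $$\Sigma=I_d-\tfrac12(I_d-Z)^{-\frac12}(S-Z)(I_d-Z)^{-\frac12}.$$ Then $\Sigma$ is symmetric, positive definite and satisfies $\Sigma_{ii}=1$ for each $i$. Moreover, with $(X_1,\dots,X_d)$ a centered Gaussian vector of covariance $\Sigma$, $$\det S=\left(\sum_{k_1,\dots,k_d=0}^\infty\frac{E[H_{k_1}(X_1)^2\cdots H_{k_d}(X_d)^2]}{k_1!\cdots k_d!}\prod_{i=1}^d\sqrt{S_{ii}}\,(1-S_{ii})^{k_i}\right)^{-2}.$$ This implies in particular the classical Hadamard inequality $\det S\le\prod_{i=1}^d S_{ii}$.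
   Context: For symmetric matrices $A,B$, $A<B$ means that $B-A$ is positive definite. The Hermite polynomials on the real line are defined by $H_0\equiv 1$ and $H_{k+1}(x)=xH_k(x)-H_k'(x)$. $E$ denotes mathematical expectation. *)

theory Defs
  imports "HOL-Probability.Probability" "HOL-Computational_Algebra.Polynomial"
begin

text \<open>Positive definite includes symmetric. The relation \<open>mat_less\<close> is the order on symmetric
  matrices given by positive definiteness of the difference; the library's \<open><\<close> on \<open>real ^ 'n ^ 'n\<close>
  is componentwise and is not used.\<close>

definition pos_def :: "real ^ 'n ^ 'n \<Rightarrow> bool" where
  "pos_def A \<longleftrightarrow> transpose A = A \<and> (\<forall>x. x \<noteq> 0 \<longrightarrow> x \<bullet> (A *v x) > 0)"

definition mat_less :: "real ^ 'n ^ 'n \<Rightarrow> real ^ 'n ^ 'n \<Rightarrow> bool" (infix \<open>\<prec>\<close> 50) where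
  "A \<prec> B \<longleftrightarrow> pos_def (B - A)"

definition diag_part :: "real ^ 'n ^ 'n \<Rightarrow> real ^ 'n ^ 'n" where
  "diag_part A = (\<chi> i j. if i = j then A $ i $ i else 0)"

text \<open>The unique positive definite square root; meaningful for positive definite \<open>A\<close> only.\<close>

definition mat_sqrt :: "real ^ 'n ^ 'n \<Rightarrow> real ^ 'n ^ 'n" where
  "mat_sqrt A = (THE R. pos_def R \<and> R ** R = A)"

definition mat_inv_sqrt :: "real ^ 'n ^ 'n \<Rightarrow> real ^ 'n ^ 'n" where
  "mat_inv_sqrt A = matrix_inv (mat_sqrt A)"

primrec Hermite :: "nat \<Rightarrow> real poly" where
  "Hermite 0 = 1"
| "Hermite (Suc k) = [:0, 1:] * Hermite k - pderiv (Hermite k)"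

text \<open>A real random variable is Gaussian if it is almost surely constant (variance \<open>0\<close>) or has a
  normal density; a random vector is Gaussian if all its linear combinations are.\<close>

definition gaussian_rv :: "'a measure \<Rightarrow> ('a \<Rightarrow> real) \<Rightarrow> bool" where
  "gaussian_rv M Y \<longleftrightarrow>
     Y \<in> borel_measurable M \<and>
     (\<exists>\<mu>. (AE \<omega> in M. Y \<omega> = \<mu>) \<or>
        (\<exists>\<sigma>>0. distributed M lborel Y (\<lambda>x. ennreal (normal_density \<mu> \<sigma> x))))"

definition gaussian_vector :: "'a measure \<Rightarrow> ('a \<Rightarrow> real ^ 'n) \<Rightarrow> bool" where
  "gaussian_vector M X \<longleftrightarrow>
     prob_space M \<and> X \<in> borel_measurable M \<and> (\<forall>u. gaussian_rv M (\<lambda>\<omega>. u \<bullet> X \<omega>))"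

definition covariance_matrix :: "'a measure \<Rightarrow> ('a \<Rightarrow> real ^ 'n) \<Rightarrow> real ^ 'n ^ 'n" where
  "covariance_matrix M X =
     (\<chi> i j. \<integral>\<omega>. (X \<omega> $ i - (\<integral>\<omega>. X \<omega> $ i \<partial>M)) * (X \<omega> $ j - (\<integral>\<omega>. X \<omega> $ j \<partial>M)) \<partial>M)"

definition centered_gaussian_vector ::
    "'a measure \<Rightarrow> ('a \<Rightarrow> real ^ 'n) \<Rightarrow> real ^ 'n ^ 'n \<Rightarrow> bool" where
  "centered_gaussian_vector M X \<Sigma> \<longleftrightarrow>
     gaussian_vector M X \<and> (\<forall>i. (\<integral>\<omega>. X \<omega> $ i \<partial>M) = 0) \<and> covariance_matrix M X = \<Sigma>"

text \<open>The summand of index \<open>k\<close>; multi-indices are functions \<open>'n \<Rightarrow> nat\<close>.\<close>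

definition hermite_term ::
    "'a measure \<Rightarrow> ('a \<Rightarrow> real ^ 'n) \<Rightarrow> real ^ 'n ^ 'n \<Rightarrow> ('n \<Rightarrow> nat) \<Rightarrow> real" where
  "hermite_term M X S k =
     (\<integral>\<omega>. (\<Prod>i\<in>UNIV. (poly (Hermite (k i)) (X \<omega> $ i))\<^sup>2) \<partial>M) / (\<Prod>i\<in>UNIV. fact (k i))
       * (\<Prod>i\<in>UNIV. sqrt (S $ i $ i) * (1 - S $ i $ i) ^ k i)"

end

theory Submission
  imports Defs
begin

text \<open>Summed under the expectation, the series becomes a Gaussian integral. Write \<open>r i = 1 - S i i\<close>. On the
  diagonal, Mehler's formula sums the Hermite series in closed form:
  \<open>\<Sum>k. H k x\<^sup>2 r^k / k! = exp (r x\<^sup>2 / (1 + r)) / sqrt (1 - r\<^sup>2)\<close>. All terms are nonnegative, so the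
  multi-index series may be summed under the expectation, and up to the weights
  \<open>w i = 1 / sqrt (1 + r i)\<close> it equals the expectation of \<open>exp (\<Sum>i. r i / (1 + r i) * (X i)\<^sup>2)\<close>.

  For a centered Gaussian vector with covariance \<open>\<Sigma>\<close>, the expectation of
  \<open>exp (\<Sum>i. (s i * X i)\<^sup>2 / 2)\<close> is \<open>det (I - s \<Sigma> s)\<close> to the power \<open>- 1/2\<close> as soon as this matrix is
  positive definite. Here \<open>s i = sqrt (2 * r i / (1 + r i))\<close>, and \<open>\<Sigma>\<close> is designed so that
  \<open>I - s \<Sigma> s = w S w\<close>, both on the diagonal and off it. The weights cancel, and the series sums to
  \<open>1 / sqrt (det S)\<close>. That \<open>\<Sigma>\<close> is positive definite comes from a second congruence, with the matrix
  \<open>2 I - Z - S\<close>.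

  The three analytic ingredients are proved by elementary means. Mehler's formula
  (\<open>Mehler_diagonal\<close>) follows from a first-order differential equation that the three-term recurrence
  imposes on the generating series. The expectation of the exponential of a quadratic form
  (\<open>nn_integral_exp_diagonal_quadratic_form\<close>) is reduced to moment generating functions of linear
  forms by introducing auxiliary normal variables, hence to the Gaussian integral
  (\<open>nn_integral_gaussian\<close>), which in turn rests on linear substitution in Lebesgue integrals
  (\<open>nn_integral_lborel_linear\<close>).

  Hadamard's inequality (\<open>Hadamard_inequality\<close>) is proved for all positive definite matrices directly
  from the Gaussian integral: it makes \<open>1 / sqrt (det A)\<close> a convex function of \<open>A\<close>, and averaging \<open>A\<close>
  over sign changes of the coordinates, which preserve the determinant, leaves its diagonal part.\<close>

section \<open>Linear substitution in Lebesgue integrals\<close>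

text \<open>Tonelli for one coordinate: integrating along a single basis direction first is what reduces
  a shear to a translation of the real line.\<close>

lemma nn_integral_lborel_split_coordinate:
  fixes f :: "'a::euclidean_space \<Rightarrow> ennreal"
  assumes [measurable]: "f \<in> borel_measurable borel" and b: "b \<in> Basis"
  shows "(\<integral>\<^sup>+x. f x \<partial>lborel) =
    (\<integral>\<^sup>+\<omega>. (\<integral>\<^sup>+y. f ((\<Sum>j\<in>Basis - {b}. \<omega> j *\<^sub>R j) + y *\<^sub>R b) \<partial>lborel) \<partial>(\<Pi>\<^sub>M j\<in>Basis - {b}. lborel))"
proof -
  interpret product_sigma_finite "\<lambda>_::'a. lborel :: real measure" ..
  have ins: "insert b (Basis - {b}) = Basis" using b by auto
  have upd: "(\<Sum>j\<in>Basis. fun_upd \<omega> b y j *\<^sub>R j) = (\<Sum>j\<in>Basis - {b}. \<omega> j *\<^sub>R j) + y *\<^sub>R b" for \<omega> y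
    by (subst sum.remove[OF _ b]) (auto simp: add.commute intro!: arg_cong2[where f="(+)"] sum.cong)
  have meas: "(\<lambda>\<omega>. f (\<Sum>j\<in>Basis. \<omega> j *\<^sub>R j)) \<in> borel_measurable (\<Pi>\<^sub>M j\<in>Basis. lborel)"
    by measurable
  have "(\<integral>\<^sup>+x. f x \<partial>lborel) = (\<integral>\<^sup>+\<omega>. f (\<Sum>j\<in>Basis. \<omega> j *\<^sub>R j) \<partial>(\<Pi>\<^sub>M j\<in>Basis. lborel))"
    by (subst lborel_eq) (simp add: nn_integral_distr)
  also have "\<dots> = (\<integral>\<^sup>+\<omega>. (\<integral>\<^sup>+y. f (\<Sum>j\<in>Basis. fun_upd \<omega> b y j *\<^sub>R j) \<partial>lborel) \<partial>(\<Pi>\<^sub>M j\<in>Basis - {b}. lborel))"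
    using product_nn_integral_insert[of "Basis - {b}" b "\<lambda>\<omega>. f (\<Sum>j\<in>Basis. \<omega> j *\<^sub>R j)"] meas
    unfolding ins by simp
  finally show ?thesis unfolding upd .
qed

text \<open>On every line parallel to \<open>b\<close> the map is a translation by the constant \<open>c x\<close>, and Lebesgue
  measure on that line does not see it.\<close>

lemma nn_integral_lborel_shear:
  fixes f :: "'a::euclidean_space \<Rightarrow> ennreal"
  assumes f [measurable]: "f \<in> borel_measurable borel" and c [measurable]: "c \<in> borel_measurable borel"
    and b: "b \<in> Basis" and inv: "\<And>x y. c (x + y *\<^sub>R b) = c x"
  shows "(\<integral>\<^sup>+x. f (x + c x *\<^sub>R b) \<partial>lborel) = (\<integral>\<^sup>+x. f x \<partial>lborel)"
proof -
  have "(\<integral>\<^sup>+y. f ((w + y *\<^sub>R b) + c (w + y *\<^sub>R b) *\<^sub>R b) \<partial>lborel) = (\<integral>\<^sup>+y. f (w + y *\<^sub>R b) \<partial>lborel)" for w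
    using nn_integral_real_affine[of "\<lambda>y. f (w + y *\<^sub>R b)" 1 "c w"]
    by (simp add: inv algebra_simps)
  then show ?thesis
    by (subst (1 2) nn_integral_lborel_split_coordinate[OF _ b]) simp_all
qed

lemma borel_measurable_matrix_vector_mult [measurable]:
  fixes A :: "real ^ 'n ^ 'm"
  shows "(*v) A \<in> borel \<rightarrow>\<^sub>M borel"
  by (intro borel_measurable_continuous_onI linear_continuous_on)
     (simp add: linear_conv_bounded_linear[symmetric])

lemma prod_Basis_cart: "(\<Prod>b\<in>Basis. g b) = (\<Prod>i\<in>UNIV. g (axis i (1::real) :: real ^ 'n))"
proof -
  have eq: "(Basis :: (real ^ 'n) set) = range (\<lambda>i. axis i 1)"
    by (auto simp: Basis_vec_def)
  show ?thesis
    unfolding eq by (subst prod.reindex) (auto simp: inj_def axis_eq_axis)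
qed

lemma nn_integral_lborel_permute:
  fixes f :: "real ^ 'n \<Rightarrow> ennreal" and p :: "'n \<Rightarrow> 'n"
  assumes [measurable]: "f \<in> borel_measurable borel" and p: "bij p"
  shows "(\<integral>\<^sup>+x. f (\<chi> i. x $ p i) \<partial>lborel) = (\<integral>\<^sup>+x. f x \<partial>lborel)"
proof -
  let ?T = "\<lambda>x :: real ^ 'n. (\<chi> i. x $ p i) :: real ^ 'n"
  have T [measurable]: "?T \<in> borel \<rightarrow>\<^sub>M borel"
    by (intro borel_measurable_continuous_onI continuous_intros)
  have bij: "bij (inv p)" using p by (rule bij_imp_bij_inv)
  have "lborel = distr lborel borel ?T"
  proof (rule lborel_eqI)
    fix l u :: "real ^ 'n" assume le: "\<And>b. b \<in> Basis \<Longrightarrow> l \<bullet> b \<le> u \<bullet> b"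
    then have le': "l $ i \<le> u $ i" for i
      using le[of "axis i 1"] by (simp add: inner_axis axis_in_Basis_iff)
    have "x \<in> ?T -` box l u \<longleftrightarrow> x \<in> box (\<chi> i. l $ inv p i) (\<chi> i. u $ inv p i)" for x
    proof -
      have "(\<forall>i. Q (x $ p i) i) \<longleftrightarrow> (\<forall>i. Q (x $ i) (inv p i))" for Q :: "real \<Rightarrow> 'n \<Rightarrow> bool"
        using p by (metis bij_inv_eq_iff)
      from this[of "\<lambda>y i. l $ i < y \<and> y < u $ i"] show ?thesis
        by (simp add: mem_box_cart)
    qed
    then have "?T -` box l u = box (\<chi> i. l $ inv p i) (\<chi> i. u $ inv p i)" by blast
    moreover have "(\<Prod>i\<in>UNIV. u $ inv p i - l $ inv p i) = (\<Prod>i\<in>UNIV. u $ i - l $ i)"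
      using prod.reindex_bij_betw[OF bij, of "\<lambda>i. u $ i - l $ i"] by simp
    moreover have "\<And>b. b \<in> Basis \<Longrightarrow> (\<chi> i. l $ inv p i) \<bullet> b \<le> (\<chi> i. u $ inv p i) \<bullet> b"
      using le' by (auto simp: Basis_vec_def inner_axis)
    ultimately show "emeasure (distr lborel borel ?T) (box l u) = (\<Prod>b\<in>Basis. (u - l) \<bullet> b)"
      by (simp add: emeasure_distr emeasure_lborel_box_eq prod_Basis_cart inner_axis)
  qed simp
  then have "integral\<^sup>N lborel f = integral\<^sup>N (distr lborel borel ?T) f"
    by (rule arg_cong)
  also have "\<dots> = (\<integral>\<^sup>+x. f (?T x) \<partial>lborel)"
    by (rule nn_integral_distr) simp_all
  finally show ?thesis ..
qed

lemma nn_integral_lborel_scale_coordinates: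
  fixes f :: "real ^ 'n \<Rightarrow> ennreal"
  assumes [measurable]: "f \<in> borel_measurable borel" and c: "\<And>i::'n. c i \<noteq> (0::real)"
  shows "ennreal \<bar>\<Prod>i\<in>UNIV. c i\<bar> * (\<integral>\<^sup>+x. f (\<chi> i. c i * x $ i) \<partial>lborel) = (\<integral>\<^sup>+x. f x \<partial>lborel)"
proof -
  \<comment> \<open>the factors, reindexed from coordinates to basis vectors\<close>
  define d where "d b = c (SOME i. b = axis i 1)" for b :: "real ^ 'n"
  have d: "d (axis i 1) = c i" for i
    unfolding d_def by (simp add: axis_eq_axis)
  let ?T = "\<lambda>x :: real ^ 'n. 0 + (\<Sum>j\<in>Basis. (d j * (x \<bullet> j)) *\<^sub>R j)"
  have T: "?T x = (\<chi> i. c i * x $ i)" for x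
  proof -
    have "(?T x) \<bullet> axis i 1 = c i * x $ i" for i
      by (simp add: inner_sum_left_Basis axis_in_Basis_iff d) (simp add: inner_axis)
    then show ?thesis by (simp add: vec_eq_iff inner_axis)
  qed
  have [measurable]: "?T \<in> borel \<rightarrow>\<^sub>M borel" by measurable
  have "d j \<noteq> 0" for j
    using c by (simp add: d_def)
  then have "lborel = density (distr lborel borel ?T) (\<lambda>_. ennreal (\<Prod>j\<in>Basis. \<bar>d j\<bar>))"
    using lborel_affine_euclidean[of d 0] by simp
  then have "integral\<^sup>N lborel f = integral\<^sup>N (density (distr lborel borel ?T) (\<lambda>_. ennreal (\<Prod>j\<in>Basis. \<bar>d j\<bar>))) f"
    by (rule arg_cong)
  also have "\<dots> = ennreal \<bar>\<Prod>i\<in>UNIV. c i\<bar> * (\<integral>\<^sup>+x. f (?T x) \<partial>lborel)"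
    by (simp add: nn_integral_density nn_integral_distr nn_integral_cmult prod_Basis_cart d abs_prod)
  finally show ?thesis unfolding T ..
qed

text \<open>The property is multiplicative in \<open>A\<close>, and every matrix is a product of elementary ones: a
  matrix with a zero row is excluded by the determinant, and diagonal matrices, transpositions and
  shears are covered by the lemmas above.\<close>

lemma nn_integral_lborel_linear:
  fixes f :: "real ^ 'n \<Rightarrow> ennreal" and A :: "real ^ 'n ^ 'n"
  assumes "f \<in> borel_measurable borel" and "det A \<noteq> 0"
  shows "ennreal \<bar>det A\<bar> * (\<integral>\<^sup>+x. f (A *v x) \<partial>lborel) = (\<integral>\<^sup>+x. f x \<partial>lborel)"
proof -
  define P where "P A \<longleftrightarrow> (det A \<noteq> 0 \<longrightarrow>
    (\<forall>f\<in>borel_measurable borel. ennreal \<bar>det A\<bar> * (\<integral>\<^sup>+x. f (A *v x) \<partial>lborel) = (\<integral>\<^sup>+x. f x \<partial>lborel)))"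
    for A :: "real ^ 'n ^ 'n"
  have "P A" for A
  proof (induction A rule: induct_matrix_elementary)
    case (1 A B)
    show ?case unfolding P_def
    proof (intro impI ballI)
      fix f :: "real ^ 'n \<Rightarrow> ennreal" assume [measurable]: "f \<in> borel_measurable borel" and "det (A ** B) \<noteq> 0"
      then have d: "det A \<noteq> 0" "det B \<noteq> 0" by (auto simp: det_mul)
      have [measurable]: "(\<lambda>x. f (A *v x)) \<in> borel_measurable borel" by measurable
      have "ennreal \<bar>det (A ** B)\<bar> * (\<integral>\<^sup>+x. f ((A ** B) *v x) \<partial>lborel)
          = ennreal \<bar>det A\<bar> * (ennreal \<bar>det B\<bar> * (\<integral>\<^sup>+x. f (A *v (B *v x)) \<partial>lborel))"
        by (simp add: det_mul abs_mult ennreal_mult mult.assoc matrix_vector_mul_assoc)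
      also have "ennreal \<bar>det B\<bar> * (\<integral>\<^sup>+x. f (A *v (B *v x)) \<partial>lborel) = (\<integral>\<^sup>+x. f (A *v x) \<partial>lborel)"
        using 1(2)[unfolded P_def, rule_format, of "\<lambda>x. f (A *v x)"] d by simp
      also have "ennreal \<bar>det A\<bar> * \<dots> = (\<integral>\<^sup>+x. f x \<partial>lborel)"
        using 1(1)[unfolded P_def, rule_format, of f] d by simp
      finally show "ennreal \<bar>det (A ** B)\<bar> * (\<integral>\<^sup>+x. f ((A ** B) *v x) \<partial>lborel) = (\<integral>\<^sup>+x. f x \<partial>lborel)" .
    qed
  next
    case (2 A i)
    then show ?case by (auto simp: P_def det_zero_row)
  next
    case (3 A)
    have Av: "A *v x = (\<chi> i. A $ i $ i * x $ i)" for x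
    proof -
      have "(\<Sum>j\<in>UNIV. A $ i $ j * x $ j) = (\<Sum>j\<in>UNIV. if j = i then A $ i $ i * x $ i else 0)" for i
        using 3 by (intro sum.cong) auto
      then show ?thesis by (simp add: vec_eq_iff matrix_vector_mult_def)
    qed
    have "det A = (\<Prod>i\<in>UNIV. A $ i $ i)" using 3 by (rule det_diagonal)
    then show ?case
      using nn_integral_lborel_scale_coordinates[where c="\<lambda>i. A $ i $ i"]
      by (auto simp: P_def Av)
  next
    case (4 m n)
    let ?p = "Transposition.transpose m n"
    let ?A = "\<chi> i j. mat 1 $ i $ ?p j :: real ^ 'n ^ 'n"
    have Av: "?A *v x = (\<chi> i. x $ ?p i)" for x
    proof -
      have "(\<Sum>j\<in>UNIV. ?A $ i $ j * x $ j) = (\<Sum>j\<in>UNIV. if j = ?p i then x $ ?p i else 0)" for i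
        by (intro sum.cong) (auto simp: mat_def)
      then show ?thesis by (simp add: vec_eq_iff matrix_vector_mult_def)
    qed
    have "\<bar>det ?A\<bar> = \<bar>of_int (sign ?p) * det (mat 1 :: real ^ 'n ^ 'n)\<bar>"
      by (subst det_permute_columns) (auto intro: permutes_swap_id)
    also have "\<dots> = 1" by (simp add: abs_mult sign_def)
    finally show ?case
      using nn_integral_lborel_permute[of _ ?p] by (auto simp: P_def Av)
  next
    \<comment> \<open>a shear: add \<open>c\<close> times coordinate \<open>n\<close> to coordinate \<open>m\<close>\<close>
    case (5 m n c)
    let ?A = "\<chi> i j. if i = m \<and> j = n then c else of_bool (i = j) :: real ^ 'n ^ 'n"
    have Av: "?A *v x = x + (c * x $ n) *\<^sub>R axis m 1" for x
    proof -
      have "(\<Sum>j\<in>UNIV. ?A $ i $ j * x $ j) = (\<Sum>j\<in>UNIV. (if j = i then x $ i else 0) +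
              (if j = n then (if i = m then c * x $ n else 0) else 0))" for i
        using 5 by (intro sum.cong) auto
      also have "\<And>i. \<dots> i = x $ i + (if i = m then c * x $ n else 0)"
        by (simp add: sum.distrib)
      finally show ?thesis by (simp add: vec_eq_iff matrix_vector_mult_def axis_def)
    qed
    have "?A = (\<chi> k. if k = m then row m (mat 1) + c *s row n (mat 1) else row k (mat 1))"
      using 5 by (auto simp: vec_eq_iff row_def mat_def)
    then have "det ?A = 1"
      using det_row_operation[OF 5, of "mat 1 :: real ^ 'n ^ 'n" c] by simp
    then show ?case
      using nn_integral_lborel_shear[of _ "\<lambda>x. c * x $ n" "axis m 1"] 5
      by (auto simp: P_def Av axis_in_Basis_iff) (simp add: axis_def)
  qed
  then show ?thesis using assms by (auto simp: P_def)
qed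

section \<open>The Gaussian integral\<close>

lemma nn_integral_normal_density: "\<sigma> > 0 \<Longrightarrow> (\<integral>\<^sup>+x. ennreal (normal_density \<mu> \<sigma> x) \<partial>lborel) = 1"
  using prob_space.emeasure_space_1[OF prob_space_normal_density[of \<sigma> \<mu>]] by (simp add: emeasure_density)

lemma pos_def_symmetric: "pos_def A \<Longrightarrow> x \<bullet> (A *v y) = y \<bullet> (A *v x)"
  unfolding pos_def_def by (metis dot_lmul_matrix inner_commute transpose_matrix_vector vector_transpose_matrix)

text \<open>Gram-Schmidt for the inner product \<open>x \<bullet> A y\<close>: the columns of \<open>V\<close> form an orthonormal basis for
  it. They are found one at a time: as long as fewer than \<open>n\<close> vectors \<open>v i\<close> are chosen, the vectors
  \<open>A v i\<close> span a proper subspace and some nonzero \<open>x\<close> is orthogonal to it.\<close>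

lemma pos_def_orthonormalize:
  fixes A :: "real ^ 'n ^ 'n"
  assumes A: "pos_def A"
  obtains V :: "real ^ 'n ^ 'n" where "transpose V ** A ** V = mat 1"
proof -
  have "\<exists>v. \<forall>i\<in>F. \<forall>j\<in>F. v i \<bullet> (A *v v j) = (if i = j then 1 else 0)" for F :: "'n set"
  proof (induction F rule: finite_induct[OF finite])
    case 1
    then show ?case by simp
  next
    case (2 k F)
    then obtain v where v: "\<And>i j. i \<in> F \<Longrightarrow> j \<in> F \<Longrightarrow> v i \<bullet> (A *v v j) = (if i = j then 1 else 0)"
      by blast
    have "dim ((\<lambda>i. A *v v i) ` F) \<le> card F"
      using 2(1) by (meson card_image_le dim_le_card finite_imageI order_trans span_superset)
    also have "card F < DIM(real ^ 'n)"
      using 2(1,2) by (simp add: card_insert_disjoint) (metis UNIV_I finite_class.finite_UNIV psubsetI psubset_card_mono subset_UNIV)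
    finally obtain x where x: "x \<noteq> 0" "\<And>i. i \<in> F \<Longrightarrow> x \<bullet> (A *v v i) = 0"
      by (metis (no_types, lifting) imageI orthogonal_def orthogonal_to_subspace_exists span_base)
    define q where "q = x \<bullet> (A *v x)"
    have q: "q > 0" using A x(1) by (simp add: q_def pos_def_def)
    define w where "w = (1 / sqrt q) *\<^sub>R x"
    have "w \<bullet> (A *v w) = 1"
      using q by (simp add: w_def matrix_vector_mult_scaleR q_def[symmetric])
    moreover have "w \<bullet> (A *v v i) = 0" "v i \<bullet> (A *v w) = 0" if "i \<in> F" for i
      using x(2)[OF that] pos_def_symmetric[OF A, of "v i" w] by (simp_all add: w_def)
    ultimately have "\<forall>i\<in>insert k F. \<forall>j\<in>insert k F.
        (v(k := w)) i \<bullet> (A *v (v(k := w)) j) = (if i = j then 1 else 0)"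
      using v 2(2) by auto
    then show ?case by blast
  qed
  then obtain v where v: "\<And>i j::'n. v i \<bullet> (A *v v j) = (if i = j then 1 else 0)"
    by (metis UNIV_I)
  define V where "V = (\<chi> i j. v j $ i)"
  have "(transpose V ** A ** V) $ i $ j = v i \<bullet> (A *v v j)" for i j
  proof -
    have "(transpose V ** A ** V) $ i $ j = (\<Sum>k\<in>UNIV. \<Sum>l\<in>UNIV. v i $ l * A $ l $ k * v j $ k)"
      by (simp add: matrix_matrix_mult_def transpose_def V_def sum_distrib_right)
    also have "\<dots> = v i \<bullet> (A *v v j)"
      by (subst sum.swap) (simp add: inner_vec_def matrix_vector_mult_def sum_distrib_left mult.assoc)
    finally show ?thesis .
  qed
  then have "transpose V ** A ** V = mat 1"
    by (simp add: vec_eq_iff v mat_def)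
  then show ?thesis by (rule that)
qed

lemma nn_integral_std_normal_density_cart:
  "(\<integral>\<^sup>+x. ennreal (\<Prod>i\<in>UNIV. std_normal_density (x $ i)) \<partial>(lborel :: (real ^ 'n) measure)) = 1"
proof -
  have "(\<integral>\<^sup>+x. ennreal (\<Prod>i\<in>UNIV. std_normal_density (x $ i)) \<partial>(lborel :: (real ^ 'n) measure))
     = (\<integral>\<^sup>+x. (\<Prod>b\<in>Basis. ennreal (std_normal_density (x \<bullet> b))) \<partial>(lborel :: (real ^ 'n) measure))"
    by (simp add: prod_Basis_cart inner_axis prod_ennreal)
  also have "\<dots> = (\<Prod>b\<in>(Basis :: (real ^ 'n) set). (\<integral>\<^sup>+x. ennreal (std_normal_density x) \<partial>lborel))"
    by (rule nn_integral_lborel_prod) auto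
  also have "(\<integral>\<^sup>+x. ennreal (std_normal_density x) \<partial>lborel) = 1"
    by (rule nn_integral_normal_density) simp
  finally show ?thesis by simp
qed

lemma prod_std_normal_density:
  "(\<Prod>i\<in>UNIV. std_normal_density (x $ i)) = (1 / sqrt (2 * pi)) ^ CARD('n) * exp (- (x \<bullet> x) / 2)"
  for x :: "real ^ 'n"
proof -
  have "(\<Prod>i\<in>UNIV. exp (- (x $ i)\<^sup>2 / 2)) = exp (- (x \<bullet> x) / 2)"
    by (simp add: exp_sum[symmetric] inner_vec_def sum_negf sum_divide_distrib power2_eq_square)
  then show ?thesis
    by (simp add: std_normal_density_def prod_dividef power_divide)
qed

text \<open>The substitution \<open>x = V y\<close> with \<open>V\<^sup>T A V = I\<close> turns the integrand into the standard normal
  density, so the integral is \<open>\<bar>det V\<bar>\<close>; and \<open>(det V)\<^sup>2 det A = 1\<close>, which also gives the sign of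
  \<open>det A\<close>.\<close>

lemma gaussian_integral:
  fixes A :: "real ^ 'n ^ 'n"
  assumes A: "pos_def A"
  shows det_pos_of_pos_def: "det A > 0"
    and nn_integral_gaussian:
      "(\<integral>\<^sup>+x. ennreal ((1 / sqrt (2 * pi)) ^ CARD('n) * exp (- (x \<bullet> (A *v x)) / 2)) \<partial>lborel) = ennreal (1 / sqrt (det A))"
proof -
  obtain V :: "real ^ 'n ^ 'n" where V: "transpose V ** A ** V = mat 1"
    using A by (rule pos_def_orthonormalize)
  have "det V * det A * det V = 1"
    using arg_cong[OF V, of det] by (simp add: det_mul)
  then have dV: "(det V)\<^sup>2 * det A = 1" by (simp add: power2_eq_square algebra_simps)
  then have "det V \<noteq> 0" by auto
  then have sq: "(det V)\<^sup>2 > 0" by simp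
  with dV show pos: "det A > 0" by (metis zero_less_mult_pos zero_less_one)
  have "(\<bar>det V\<bar> * sqrt (det A))\<^sup>2 = 1" using dV pos by (simp add: power_mult_distrib)
  then have absV: "\<bar>det V\<bar> = 1 / sqrt (det A)"
    using power2_eq_imp_eq[of "\<bar>det V\<bar> * sqrt (det A)" 1] pos by (simp add: field_simps)
  let ?f = "\<lambda>x. ennreal ((1 / sqrt (2 * pi)) ^ CARD('n) * exp (- (x \<bullet> (A *v x)) / 2))"
  have "(V *v x) \<bullet> (A *v (V *v x)) = x \<bullet> ((transpose V ** A ** V) *v x)" for x
    by (simp add: dot_lmul_matrix matrix_vector_mul_assoc[symmetric])
       (metis dot_lmul_matrix transpose_matrix_vector vector_transpose_matrix)
  then have "?f (V *v x) = ennreal (\<Prod>i\<in>UNIV. std_normal_density (x $ i))" for x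
    by (simp add: V prod_std_normal_density)
  moreover have "?f \<in> borel_measurable borel" by measurable
  ultimately show "(\<integral>\<^sup>+x. ?f x \<partial>lborel) = ennreal (1 / sqrt (det A))"
    using nn_integral_lborel_linear[of ?f V] \<open>det V \<noteq> 0\<close>
    by (simp add: nn_integral_std_normal_density_cart absV)
qed

section \<open>Diagonal matrices and positive definiteness\<close>

definition diag_matrix :: "('n \<Rightarrow> real) \<Rightarrow> real ^ 'n ^ 'n" where
  "diag_matrix c = (\<chi> i j. if i = j then c i else 0)"

lemma diag_matrix_mult_vec: "diag_matrix c *v x = (\<chi> i. c i * x $ i)"
  by (simp add: vec_eq_iff diag_matrix_def matrix_vector_mult_def if_distrib if_distribR sum.delta cong: if_cong)

lemma diag_matrix_congruence:
  "diag_matrix b ** A ** diag_matrix c = (\<chi> i j. b i * A $ i $ j * c j)"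
proof -
  have "(\<Sum>k\<in>UNIV. (\<Sum>l\<in>UNIV. (if i = l then b i else 0) * A $ l $ k) * (if k = j then c k else 0))
      = b i * A $ i $ j * c j" for i j
    by (simp add: if_distrib if_distribR sum.delta sum.delta' cong: if_cong)
  then show ?thesis
    by (simp add: vec_eq_iff diag_matrix_def matrix_matrix_mult_def)
qed

lemma diag_matrix_mult: "diag_matrix b ** diag_matrix c = diag_matrix (\<lambda>i. b i * c i)"
proof -
  have "diag_matrix b ** mat 1 ** diag_matrix c = diag_matrix (\<lambda>i. b i * c i)"
    unfolding diag_matrix_congruence by (simp add: vec_eq_iff diag_matrix_def mat_def)
  then show ?thesis by simp
qed

lemma det_diag_matrix: "det (diag_matrix c) = (\<Prod>i\<in>UNIV. c i)"
  by (subst det_diagonal) (auto simp: diag_matrix_def)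

lemma det_diagonal_congruence:
  fixes A :: "real ^ 'n ^ 'n"
  shows "det (\<chi> i j. c i * A $ i $ j * c j) = (\<Prod>i\<in>UNIV. c i)\<^sup>2 * det A"
  using arg_cong[OF diag_matrix_congruence[of c A c], of det]
  by (simp add: det_mul det_diag_matrix power2_eq_square mult_ac)

lemma pos_def_diagonal_congruence:
  assumes A: "pos_def A" and c: "\<And>i. c i \<noteq> 0"
  shows "pos_def (\<chi> i j. c i * A $ i $ j * c j)"
proof -
  have sym: "A $ i $ j = A $ j $ i" for i j
    using A by (auto simp: pos_def_def transpose_def vec_eq_iff)
  have "x \<bullet> ((\<chi> i j. c i * A $ i $ j * c j) *v x) > 0" if "x \<noteq> 0" for x
  proof -
    let ?y = "\<chi> i. c i * x $ i"
    have "?y \<noteq> 0" using that c by (auto simp: vec_eq_iff)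
    then have "?y \<bullet> (A *v ?y) > 0" using A by (simp add: pos_def_def)
    also have "?y \<bullet> (A *v ?y) = x \<bullet> ((\<chi> i j. c i * A $ i $ j * c j) *v x)"
      by (simp add: inner_vec_def matrix_vector_mult_def sum_distrib_left algebra_simps)
    finally show ?thesis .
  qed
  then show ?thesis by (auto simp: pos_def_def transpose_def vec_eq_iff sym)
qed

lemma pos_def_mat_1: "pos_def (mat 1)"
  by (simp add: pos_def_def transpose_mat)

lemma pos_def_diag_entry: "pos_def A \<Longrightarrow> A $ i $ i > 0"
  unfolding pos_def_def
  by (drule conjunct2, drule spec[of _ "axis i 1"])
     (simp add: inner_axis' matrix_vector_mult_basis column_def axis_eq_0_iff)

lemma pos_def_diag_matrix:
  assumes "\<And>i. c i > 0"
  shows "pos_def (diag_matrix c)"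
proof -
  have "c i \<noteq> 0" for i using assms[of i] by simp
  then have "pos_def (\<chi> i j. sqrt (c i) * (mat 1 :: real ^ _ ^ _) $ i $ j * sqrt (c j))"
    by (intro pos_def_diagonal_congruence pos_def_mat_1) simp
  also have "(\<chi> i j. sqrt (c i) * (mat 1 :: real ^ _ ^ _) $ i $ j * sqrt (c j)) = diag_matrix c"
    using assms by (auto simp: vec_eq_iff diag_matrix_def mat_def abs_of_pos)
  finally show ?thesis .
qed

text \<open>Uniqueness of the square root. If \<open>R\<close> is positive definite with \<open>R\<^sup>2 = Q\<^sup>2\<close> for the diagonal
  matrix \<open>Q\<close> of the roots \<open>q\<close>, then each column \<open>v = (R - Q) e\<close> satisfies \<open>R v = - q v\<close>, since
  \<open>R\<^sup>2 e = q\<^sup>2 e\<close>. A positive definite matrix has no eigenvalue \<open>- q < 0\<close>, so \<open>v = 0\<close>.\<close>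

lemma mat_sqrt_diag_matrix:
  assumes d: "\<And>i. d i > 0"
  shows "mat_sqrt (diag_matrix d) = diag_matrix (\<lambda>i. sqrt (d i))"
  unfolding mat_sqrt_def
proof (rule the_equality)
  let ?Q = "diag_matrix (\<lambda>i. sqrt (d i))"
  show "pos_def ?Q \<and> ?Q ** ?Q = diag_matrix d"
    using d less_imp_le[OF d] by (simp add: pos_def_diag_matrix diag_matrix_mult)
  fix R assume R: "pos_def R \<and> R ** R = diag_matrix d"
  have "(R - ?Q) *v axis j 1 = 0" for j
  proof (rule ccontr)
    let ?e = "axis j 1" and ?q = "sqrt (d j)"
    let ?v = "(R - ?Q) *v ?e"
    assume "?v \<noteq> 0"
    then have pos: "?v \<bullet> (R *v ?v) > 0" "?v \<bullet> ?v > 0" using R by (auto simp: pos_def_def)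
    have Q: "?Q *v ?e = ?q *\<^sub>R ?e" by (auto simp: diag_matrix_mult_vec vec_eq_iff axis_def)
    have D: "R *v (R *v ?e) = (?q * ?q) *\<^sub>R ?e"
    proof -
      have "R *v (R *v ?e) = diag_matrix d *v ?e" using R by (simp add: matrix_vector_mul_assoc)
      then show ?thesis using less_imp_le[OF d] by (auto simp: diag_matrix_mult_vec vec_eq_iff axis_def)
    qed
    have "R *v ?v = - ?q *\<^sub>R ?v"
      by (simp add: matrix_vector_mult_diff_rdistrib matrix_vector_mult_diff_distrib Q D
          matrix_vector_mult_scaleR scaleR_diff_right)
    then have "?v \<bullet> (R *v ?v) = - (?q * (?v \<bullet> ?v))" by simp
    moreover have "?q * (?v \<bullet> ?v) > 0" using d pos by simp
    ultimately show False using pos by linarith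
  qed
  then show "R = ?Q"
    by (simp add: vec_eq_iff matrix_vector_mult_basis column_def)
qed

lemma mat_inv_sqrt_diag_matrix:
  assumes d: "\<And>i. d i > 0"
  shows "mat_inv_sqrt (diag_matrix d) = diag_matrix (\<lambda>i. 1 / sqrt (d i))"
proof -
  let ?Q = "diag_matrix (\<lambda>i. sqrt (d i))" and ?P = "diag_matrix (\<lambda>i. 1 / sqrt (d i))"
  have "sqrt (d i) \<noteq> 0" for i using d[of i] by simp
  then have QP: "?Q ** ?P = mat 1" and PQ: "?P ** ?Q = mat 1"
    by (simp_all add: diag_matrix_mult) (simp_all add: diag_matrix_def mat_def)
  then have "?Q ** matrix_inv ?Q = mat 1"
    unfolding matrix_inv_def by (metis (mono_tags, lifting) someI_ex)
  then have "?P ** (?Q ** matrix_inv ?Q) = ?P" by simp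
  then have "matrix_inv ?Q = ?P" by (simp add: matrix_mul_assoc PQ)
  then show ?thesis
    unfolding mat_inv_sqrt_def mat_sqrt_diag_matrix[OF d] .
qed

section \<open>Hadamard's inequality\<close>

text \<open>An instance of the log-concavity of the determinant: the Gaussian integral expresses
  \<open>1 / sqrt (det A)\<close> as an integral of \<open>exp (- x \<bullet> A x / 2)\<close>, which is a convex function of \<open>A\<close>.\<close>

lemma det_midpoint_ge:
  fixes A B C :: "real ^ 'n ^ 'n"
  assumes A: "pos_def A" and B: "pos_def B" and eq: "det A = det B" and C: "C = (1 / 2) *\<^sub>R (A + B)"
  shows "pos_def C" and "det A \<le> det C"
proof -
  have quad: "x \<bullet> (C *v x) = (x \<bullet> (A *v x) + x \<bullet> (B *v x)) / 2" for x
    by (simp add: C scaleR_matrix_vector_assoc[symmetric] matrix_vector_mult_add_rdistrib inner_add_right)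
  show pd: "pos_def C"
    using A B unfolding pos_def_def quad by (auto simp: C transpose_def vec_eq_iff add_pos_pos)
  define f where "f A x = ennreal ((1 / sqrt (2 * pi)) ^ CARD('n) * exp (- (x \<bullet> (A *v x)) / 2))"
    for A :: "real ^ 'n ^ 'n" and x
  have [measurable]: "f A \<in> borel_measurable borel" for A unfolding f_def by measurable
  have half: "ennreal (1 / 2) * (ennreal p + ennreal q) = ennreal ((p + q) / 2)"
    if "p \<ge> 0" "q \<ge> 0" for p q
  proof -
    have "ennreal (1 / 2) * (ennreal p + ennreal q) = ennreal (1 / 2 * (p + q))"
      using that by (subst ennreal_mult') auto
    then show ?thesis by simp
  qed
  have "f C x \<le> ennreal (1 / 2) * (f A x + f B x)" for x
  proof -
    have amgm: "exp ((a + b) / 2) \<le> (exp a + exp b) / 2" for a b :: real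
    proof -
      have "exp ((a + b) / 2) = exp (a / 2) * exp (b / 2)" by (simp add: exp_add[symmetric] add_divide_distrib)
      moreover have "(exp (a / 2))\<^sup>2 = exp a" "(exp (b / 2))\<^sup>2 = exp b" by (simp_all add: exp_double[symmetric])
      ultimately show ?thesis using sum_squares_bound[of "exp (a / 2)" "exp (b / 2)"] by simp
    qed
    have "exp (- (x \<bullet> (C *v x)) / 2) \<le> (exp (- (x \<bullet> (A *v x)) / 2) + exp (- (x \<bullet> (B *v x)) / 2)) / 2"
    proof -
      have "- (x \<bullet> (C *v x)) / 2 = (- (x \<bullet> (A *v x)) / 2 + - (x \<bullet> (B *v x)) / 2) / 2"
        unfolding quad by (simp add: field_simps)
      then show ?thesis by (simp only: amgm)
    qed
    then have "(1 / sqrt (2 * pi)) ^ CARD('n) * exp (- (x \<bullet> (C *v x)) / 2)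
        \<le> (1 / sqrt (2 * pi)) ^ CARD('n) * ((exp (- (x \<bullet> (A *v x)) / 2) + exp (- (x \<bullet> (B *v x)) / 2)) / 2)"
      by (intro mult_left_mono) auto
    then show ?thesis
      unfolding f_def by (subst half) (auto intro!: ennreal_leI simp: distrib_left)
  qed
  then have "(\<integral>\<^sup>+x. f C x \<partial>lborel) \<le> (\<integral>\<^sup>+x. ennreal (1 / 2) * (f A x + f B x) \<partial>lborel)"
    by (intro nn_integral_mono)
  also have "\<dots> = ennreal (1 / 2) * ((\<integral>\<^sup>+x. f A x \<partial>lborel) + (\<integral>\<^sup>+x. f B x \<partial>lborel))"
    by (simp add: nn_integral_cmult nn_integral_add)
  finally have "ennreal (1 / sqrt (det C)) \<le> ennreal (1 / 2) * (ennreal (1 / sqrt (det A)) + ennreal (1 / sqrt (det B)))"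
    unfolding f_def nn_integral_gaussian[OF pd] nn_integral_gaussian[OF A] nn_integral_gaussian[OF B] .
  also have "\<dots> = ennreal (1 / sqrt (det A))"
    using det_pos_of_pos_def[OF A] by (subst half) (auto simp: eq)
  finally show "det A \<le> det C"
    using det_pos_of_pos_def[OF A] det_pos_of_pos_def[OF pd] by (simp add: field_simps)
qed

text \<open>Flipping the sign of one coordinate preserves the determinant, and the midpoint of a matrix and
  its flipped copy has the off-diagonal entries of that row and column erased. By the midpoint
  inequality each erasure can only increase the determinant; erasing every row and column leaves the
  diagonal.\<close>

theorem Hadamard_inequality:
  assumes A: "pos_def A"
  shows "det A \<le> (\<Prod>i\<in>UNIV. A $ i $ i)"
proof -
  \<comment> \<open>\<open>A\<close> with the off-diagonal entries of the rows and columns in \<open>F\<close> erased\<close>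
  define T where "T F = (\<chi> i j. if i = j \<or> (i \<notin> F \<and> j \<notin> F) then A $ i $ j else 0)" for F
  have "pos_def (T F) \<and> det A \<le> det (T F)" for F
  proof (induction F rule: finite_induct[OF finite])
    case 1
    have "T {} = A" by (simp add: T_def vec_eq_iff)
    then show ?case using A by simp
  next
    case (2 k F)
    define \<epsilon> where "\<epsilon> i = (if i = k then -1 else 1 :: real)" for i
    let ?B = "\<chi> i j. \<epsilon> i * T F $ i $ j * \<epsilon> j"
    have "pos_def ?B" using 2 by (intro pos_def_diagonal_congruence) (auto simp: \<epsilon>_def)
    moreover have "det (T F) = det ?B"
      by (simp add: det_diagonal_congruence \<epsilon>_def)
    moreover have "T (insert k F) = (1 / 2) *\<^sub>R (T F + ?B)"
      by (auto simp: vec_eq_iff T_def \<epsilon>_def)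
    ultimately show ?case using det_midpoint_ge[of "T F" ?B "T (insert k F)"] 2 by auto
  qed
  from this[of UNIV] have "det A \<le> det (T UNIV)" by simp
  also have "T UNIV = diag_matrix (\<lambda>i. A $ i $ i)" by (auto simp: T_def diag_matrix_def vec_eq_iff)
  finally show ?thesis by (simp add: det_diag_matrix)
qed

section \<open>Mehler's formula on the diagonal\<close>

lemma pderiv_Hermite: "pderiv (Hermite (Suc k)) = smult (of_nat (Suc k)) (Hermite k)"
proof (induction k)
  case 0
  then show ?case by (simp add: pderiv_pCons)
next
  case (Suc k)
  have "pderiv (Hermite (Suc (Suc k))) = Hermite (Suc k) + [:0, 1:] * pderiv (Hermite (Suc k))
      - pderiv (pderiv (Hermite (Suc k)))"
    by (subst Hermite.simps(2)[of "Suc k"], unfold pderiv_diff pderiv_mult)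
       (simp add: pderiv_pCons del: Hermite.simps)
  also have "\<dots> = Hermite (Suc k) + smult (of_nat (Suc k)) ([:0, 1:] * Hermite k - pderiv (Hermite k))"
    unfolding Suc by (simp only: pderiv_smult mult_smult_right smult_diff_right)
  also have "\<dots> = smult (of_nat (Suc (Suc k))) (Hermite (Suc k))"
    by (simp only: Hermite.simps(2)[symmetric] of_nat_Suc[of "Suc k"] smult_add_left smult_1_left)
  finally show ?case .
qed

lemma Hermite_recurrence:
  "poly (Hermite (Suc (Suc k))) x = x * poly (Hermite (Suc k)) x - real (Suc k) * poly (Hermite k) x"
  by (simp only: Hermite.simps(2)[of "Suc k"] pderiv_Hermite) simp

text \<open>For the normalized values \<open>a k = \<bar>H k x\<bar> / sqrt (k!)\<close> the recurrence gives
  \<open>a (k + 2) \<le> \<bar>x\<bar> / sqrt (k + 2) * a (k + 1) + a k\<close>, and the first coefficient tends to \<open>0\<close>. So \<open>a\<close>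
  grows more slowly than \<open>(1 + \<epsilon>)^k\<close> for every \<open>\<epsilon> > 0\<close>, which is what convergence on the whole unit disc needs.\<close>

lemma Hermite_growth:
  assumes "\<epsilon> > 0"
  shows "\<exists>C. \<forall>k. \<bar>poly (Hermite k) x\<bar> / sqrt (fact k) \<le> C * (1 + \<epsilon>) ^ k"
proof -
  define a where "a k = \<bar>poly (Hermite k) x\<bar> / sqrt (fact k)" for k
  have a_nonneg: "a k \<ge> 0" for k by (simp add: a_def)
  have rec: "a (Suc (Suc k)) \<le> \<bar>x\<bar> / sqrt (real (Suc (Suc k))) * a (Suc k) + a k" for k
  proof -
    have "\<bar>poly (Hermite (Suc (Suc k))) x\<bar> \<le> \<bar>x\<bar> * \<bar>poly (Hermite (Suc k)) x\<bar> + real (Suc k) * \<bar>poly (Hermite k) x\<bar>"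
      unfolding Hermite_recurrence by (rule order_trans[OF abs_triangle_ineq4]) (simp add: abs_mult)
    then have "a (Suc (Suc k)) \<le> (\<bar>x\<bar> * \<bar>poly (Hermite (Suc k)) x\<bar> + real (Suc k) * \<bar>poly (Hermite k) x\<bar>)
        / sqrt (fact (Suc (Suc k)))"
      unfolding a_def by (intro divide_right_mono) auto
    also have "\<dots> = \<bar>x\<bar> / sqrt (real (Suc (Suc k))) * a (Suc k)
        + real (Suc k) / (sqrt (real (Suc (Suc k))) * sqrt (real (Suc k))) * a k"
      by (simp only: a_def fact_Suc real_sqrt_mult of_nat_mult add_divide_distrib) simp
    also have "real (Suc k) / (sqrt (real (Suc (Suc k))) * sqrt (real (Suc k))) * a k \<le> 1 * a k"
    proof (intro mult_right_mono a_nonneg)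
      have "real (Suc k) = sqrt (real (Suc k)) * sqrt (real (Suc k))" by simp
      also have "\<dots> \<le> sqrt (real (Suc (Suc k))) * sqrt (real (Suc k))"
        by (intro mult_right_mono) auto
      finally show "real (Suc k) / (sqrt (real (Suc (Suc k))) * sqrt (real (Suc k))) \<le> 1"
        by (simp only: divide_le_eq_1) simp
    qed
    finally show ?thesis by simp
  qed
  obtain K :: nat where K: "(\<bar>x\<bar> / \<epsilon>)\<^sup>2 \<le> real K" using real_arch_simple by blast
  have small: "\<bar>x\<bar> / sqrt (real (Suc (Suc k))) \<le> \<epsilon>" if "k \<ge> K" for k
  proof -
    have "\<bar>x\<bar> / \<epsilon> \<le> sqrt (real (Suc (Suc k)))"
      using K that by (intro real_le_rsqrt) linarith
    then show ?thesis using assms by (simp add: field_simps)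
  qed
  define C where "C = (\<Sum>k\<le>Suc K. a k)"
  have C: "C \<ge> 0" unfolding C_def by (intro sum_nonneg a_nonneg)
  have init: "a k \<le> C * (1 + \<epsilon>) ^ k" if "k \<le> Suc K" for k
  proof -
    have "a k \<le> C" unfolding C_def using that by (intro member_le_sum a_nonneg) auto
    also have "C * 1 \<le> C * (1 + \<epsilon>) ^ k" using C assms by (intro mult_left_mono) auto
    finally show ?thesis by simp
  qed
  have "a k \<le> C * (1 + \<epsilon>) ^ k" for k
  proof (induction k rule: less_induct)
    case (less k)
    show ?case
    proof (cases "k \<le> Suc K")
      case False
      then obtain j where j: "k = Suc (Suc j)" "j \<ge> K"
        by (metis Suc_le_D not_less_eq_eq)
      have "a k \<le> \<bar>x\<bar> / sqrt (real (Suc (Suc j))) * a (Suc j) + a j" using rec j by simp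
      also have "\<dots> \<le> \<epsilon> * (C * (1 + \<epsilon>) ^ Suc j) + C * (1 + \<epsilon>) ^ j"
        using small[OF j(2)] less.IH[of "Suc j"] less.IH[of j] j assms a_nonneg
        by (intro add_mono mult_mono) auto
      also have "\<dots> = C * (1 + \<epsilon>) ^ j * (\<epsilon> * (1 + \<epsilon>) + 1)" by (simp add: algebra_simps)
      \<comment> \<open>\<open>1 + \<epsilon> + \<epsilon>\<^sup>2 \<le> (1 + \<epsilon>)\<^sup>2\<close>\<close>
      also have "\<dots> \<le> C * (1 + \<epsilon>) ^ j * ((1 + \<epsilon>) * (1 + \<epsilon>))"
        using C assms by (intro mult_left_mono) (auto simp: algebra_simps)
      finally show ?thesis by (simp add: j algebra_simps)
    qed (rule init)
  qed
  then show ?thesis unfolding a_def by blast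
qed

definition hermite_fps :: "real \<Rightarrow> real fps" where
  "hermite_fps x = Abs_fps (\<lambda>k. (poly (Hermite k) x)\<^sup>2 / fact k)"

lemma hermite_fps_conv_radius: "fps_conv_radius (hermite_fps x) \<ge> 1"
  unfolding fps_conv_radius_def
proof (rule conv_radius_geI_ex)
  fix r :: real assume r: "0 < r" "ereal r < 1"
  then have r1: "r < 1" by simp
  \<comment> \<open>chosen so that \<open>(1 + \<epsilon>)\<^sup>2 r = 2 r / (1 + r) < 1\<close>\<close>
  define \<epsilon> where "\<epsilon> = sqrt (2 / (1 + r)) - 1"
  have "\<epsilon> > 0" using r r1 by (simp add: \<epsilon>_def)
  have sq: "(1 + \<epsilon>)\<^sup>2 = 2 / (1 + r)" using r by (simp add: \<epsilon>_def)
  have q: "0 \<le> (1 + \<epsilon>)\<^sup>2 * r" "(1 + \<epsilon>)\<^sup>2 * r < 1" unfolding sq using r r1 by (auto simp: field_simps)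
  obtain C where C: "\<And>k. \<bar>poly (Hermite k) x\<bar> / sqrt (fact k) \<le> C * (1 + \<epsilon>) ^ k"
    using Hermite_growth[OF \<open>\<epsilon> > 0\<close>] by blast
  have "summable (\<lambda>k. fps_nth (hermite_fps x) k * r ^ k)"
  proof (rule summable_comparison_test')
    show "summable (\<lambda>k. C\<^sup>2 * ((1 + \<epsilon>)\<^sup>2 * r) ^ k)"
      using q by (intro summable_mult summable_geometric) simp
    fix k :: nat
    have "(poly (Hermite k) x)\<^sup>2 / fact k = (\<bar>poly (Hermite k) x\<bar> / sqrt (fact k))\<^sup>2"
      by (simp add: power_divide)
    also have "\<dots> \<le> (C * (1 + \<epsilon>) ^ k)\<^sup>2" using C by (intro power_mono) auto
    finally have "(poly (Hermite k) x)\<^sup>2 / fact k * r ^ k \<le> (C * (1 + \<epsilon>) ^ k)\<^sup>2 * r ^ k"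
      using r by (intro mult_right_mono) auto
    also have "\<dots> = C\<^sup>2 * ((1 + \<epsilon>)\<^sup>2 * r) ^ k"
      by (simp add: power_mult_distrib power_mult[symmetric] mult.commute)
    finally show "norm (fps_nth (hermite_fps x) k * r ^ k) \<le> C\<^sup>2 * ((1 + \<epsilon>)\<^sup>2 * r) ^ k"
      using r by (simp add: hermite_fps_def abs_mult)
  qed
  then show "\<exists>z. norm z = r \<and> summable (\<lambda>n. fps_nth (hermite_fps x) n * z ^ n)"
    using r by (intro exI[of _ r]) auto
qed

text \<open>Write \<open>F\<close> for the series and \<open>G\<close> for the companion series of \<open>H k x * H (k + 1) x / k!\<close>. Applying
  the three-term recurrence to one factor of each product, coefficient by coefficient, yields the two
  relations \<open>(1 + X) G = x F\<close> and \<open>(1 - X\<^sup>2) F' = x (1 - X) G + X F\<close>. Eliminating \<open>G\<close> leaves a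
  linear differential equation of first order for \<open>F\<close>.\<close>

lemma hermite_fps_ode:
  "(1 + fps_X) * (1 - fps_X\<^sup>2) * fps_deriv (hermite_fps x)
   = (fps_const (x\<^sup>2) * (1 - fps_X) + fps_X * (1 + fps_X)) * hermite_fps x"
proof -
  define H where "H k = poly (Hermite k) x" for k
  define F where "F = hermite_fps x"
  define G where "G = Abs_fps (\<lambda>k. H k * H (Suc k) / fact k)"
  have F: "fps_nth F k = (H k)\<^sup>2 / fact k" for k by (simp add: F_def hermite_fps_def H_def)
  have F': "fps_nth (fps_deriv F) k = (H (Suc k))\<^sup>2 / fact k" for k
    by (simp add: F fact_Suc field_simps del: of_nat_Suc)
  have H0: "H 0 = 1" "H (Suc 0) = x" by (simp_all add: H_def pderiv_pCons)
  have rec: "H (Suc (Suc k)) = x * H (Suc k) - real (Suc k) * H k" for k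
    unfolding H_def by (rule Hermite_recurrence)
  have 1: "(1 + fps_X) * G = fps_const x * F"
  proof (rule fps_ext)
    fix k
    show "fps_nth ((1 + fps_X) * G) k = fps_nth (fps_const x * F) k"
    proof (cases k)
      case 0
      then show ?thesis by (simp add: F G_def H0 algebra_simps)
    next
      case (Suc j)
      then have "fps_nth ((1 + fps_X) * G) k = H (Suc j) * H (Suc (Suc j)) / fact (Suc j) + H j * H (Suc j) / fact j"
        by (simp add: G_def distrib_right)
      also have "\<dots> = (H (Suc j) * H (Suc (Suc j)) + real (Suc j) * H j * H (Suc j)) / fact (Suc j)"
        by (simp only: fact_Suc of_nat_mult) (simp add: field_simps del: of_nat_Suc)
      also have "\<dots> = x * (H (Suc j))\<^sup>2 / fact (Suc j)"
        by (simp add: rec power2_eq_square algebra_simps)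
      finally show ?thesis by (simp add: F Suc)
    qed
  qed
  have 2: "(1 - fps_X\<^sup>2) * fps_deriv F = fps_const x * (1 - fps_X) * G + fps_X * F"
  proof (rule fps_ext)
    fix k
    have lhs: "fps_nth ((1 - fps_X\<^sup>2) * fps_deriv F) k = fps_nth (fps_deriv F) k - (if k < 2 then 0 else fps_nth (fps_deriv F) (k - 2))"
      by (simp only: left_diff_distrib fps_sub_nth fps_X_power_mult_nth mult_1_left)
    have rhs: "fps_nth (fps_const x * (1 - fps_X) * G + fps_X * F) k
      = x * fps_nth G k - (if k = 0 then 0 else x * fps_nth G (k - 1)) + (if k = 0 then 0 else fps_nth F (k - 1))"
      by (simp add: algebra_simps mult.assoc[of "fps_const _"] mult.left_commute[of _ "fps_const x"])
    consider "k = 0" | "k = 1" | j where "k = Suc (Suc j)" by (metis One_nat_def not0_implies_Suc)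
    then show "fps_nth ((1 - fps_X\<^sup>2) * fps_deriv F) k = fps_nth (fps_const x * (1 - fps_X) * G + fps_X * F) k"
    proof cases
      case 1
      then show ?thesis unfolding lhs rhs by (simp add: F G_def H0 power2_eq_square)
    next
      case 2
      then show ?thesis unfolding lhs rhs by (simp add: F' F G_def H0 rec[of 0] power2_eq_square field_simps)
    next
      case (3 j)
      define u v p m where "u = H (Suc j)" and "v = H (Suc (Suc j))" and "p = real (Suc j)" and "m = (fact j :: real)"
      have w: "H (Suc (Suc (Suc j))) = x * v - (p + 1) * u" unfolding u_def v_def p_def by (simp add: rec)
      have pos: "p > 0" "p + 1 > 0" "m > 0" by (simp_all add: p_def m_def)
      have f: "fact (Suc j) = p * m" "fact (Suc (Suc j)) = (p + 1) * p * m"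
        by (simp_all add: p_def m_def algebra_simps)
      define N where "N = (p + 1) * p * m"
      have frac: "u\<^sup>2 / m = (p + 1) * p * u\<^sup>2 / N" "u * v / (p * m) = (p + 1) * u * v / N"
          "u\<^sup>2 / (p * m) = (p + 1) * u\<^sup>2 / N"
        using pos by (simp_all add: N_def)
      have "(x * v - (p + 1) * u)\<^sup>2 - (p + 1) * p * u\<^sup>2
         = x * (v * (x * v - (p + 1) * u)) - x * ((p + 1) * u * v) + (p + 1) * u\<^sup>2"
        by (simp add: power2_eq_square algebra_simps)
      from arg_cong[OF this, of "\<lambda>y. y / N"]
      have "(x * v - (p + 1) * u)\<^sup>2 / ((p + 1) * p * m) - u\<^sup>2 / m
         = x * (v * (x * v - (p + 1) * u) / ((p + 1) * p * m)) - x * (u * v / (p * m)) + u\<^sup>2 / (p * m)"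
        unfolding frac N_def[symmetric] by (simp only: diff_divide_distrib add_divide_distrib times_divide_eq_right)
      then show ?thesis
        unfolding lhs rhs unfolding 3 by (simp add: F' F G_def f w u_def[symmetric] v_def[symmetric] m_def[symmetric] del: fact_Suc fps_deriv_nth)
    qed
  qed
  have "(1 + fps_X) * (1 - fps_X\<^sup>2) * fps_deriv F
     = (1 + fps_X) * (fps_const x * (1 - fps_X) * G + fps_X * F)"
    by (simp add: 2 mult.assoc)
  also have "\<dots> = fps_const x * (1 - fps_X) * ((1 + fps_X) * G) + fps_X * (1 + fps_X) * F"
    by (simp add: algebra_simps)
  also have "\<dots> = (fps_const (x\<^sup>2) * (1 - fps_X) + fps_X * (1 + fps_X)) * F"
    unfolding 1 by (simp add: power2_eq_square fps_const_mult[symmetric] algebra_simps del: fps_const_mult)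
  finally show ?thesis unfolding F_def .
qed

text \<open>Mehler's formula on the diagonal. Inside the unit disc the differential equation reads
  \<open>F' / F = x\<^sup>2 / (1 + t)\<^sup>2 + t / (1 - t\<^sup>2)\<close>, so the product of \<open>F\<close> with the reciprocal of the claimed
  value has derivative zero, and at \<open>t = 0\<close> it is \<open>1\<close>.\<close>

theorem Mehler_diagonal:
  assumes "\<bar>r\<bar> < 1"
  shows "(\<lambda>k. (poly (Hermite k) x)\<^sup>2 / fact k * r ^ k) sums (exp (r / (1 + r) * x\<^sup>2) / sqrt (1 - r\<^sup>2))"
proof -
  define F where "F = eval_fps (hermite_fps x)"
  define g where "g t = F t * sqrt (1 - t\<^sup>2) * exp (- (t / (1 + t) * x\<^sup>2))" for t
  let ?I = "{-1<..<1 :: real}"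
  have rad: "ereal (norm t) < fps_conv_radius (hermite_fps x)" if "t \<in> ?I" for t
    using that by (intro less_le_trans[OF _ hermite_fps_conv_radius]) auto
  have "(g has_field_derivative 0) (at t within ?I)" if t: "t \<in> ?I" for t
  proof -
    define D where "D = eval_fps (fps_deriv (hermite_fps x)) t"
    define s where "s = sqrt (1 - t\<^sup>2)"
    define e where "e = exp (- (t / (1 + t) * x\<^sup>2))"
    have t2: "t\<^sup>2 < 1" using t by (simp add: abs_square_less_1 abs_if)
    have s: "s > 0" "s * s = 1 - t\<^sup>2" using t2 by (simp_all add: s_def)
    have ode: "(1 + t) * (1 - t\<^sup>2) * D = (x\<^sup>2 * (1 - t) + t * (1 + t)) * F t"
    proof -
      have rad': "ereal \<bar>t\<bar> < fps_conv_radius (fps_deriv (hermite_fps x))"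
        using rad[OF t] fps_conv_radius_deriv[of "hermite_fps x"] by (auto intro: less_le_trans)
      have poly1: "(1 + fps_X) * (1 - fps_X\<^sup>2) = fps_of_poly ([:1, 1:] * [:1, 0, -1 :: real:])"
        by (simp add: fps_of_poly_pCons power2_eq_square algebra_simps)
      have poly2: "fps_const (x\<^sup>2) * (1 - fps_X) + fps_X * (1 + fps_X) = fps_of_poly [:x\<^sup>2, 1 - x\<^sup>2, 1:]"
        by (simp add: fps_of_poly_pCons fps_const_sub[symmetric] algebra_simps del: fps_const_sub)
      have "eval_fps (fps_of_poly ([:1, 1:] * [:1, 0, -1:]) * fps_deriv (hermite_fps x)) t
          = eval_fps (fps_of_poly [:x\<^sup>2, 1 - x\<^sup>2, 1:] * hermite_fps x) t"
        using hermite_fps_ode[of x] by (simp only: poly1 poly2)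
      then have "poly ([:1, 1:] * [:1, 0, -1:]) t * D = poly [:x\<^sup>2, 1 - x\<^sup>2, 1:] t * F t"
        using rad[OF t] rad' by (simp add: eval_fps_mult D_def F_def)
      then show ?thesis by (simp add: power2_eq_square algebra_simps)
    qed
    have dF: "(F has_field_derivative D) (at t within ?I)"
      unfolding F_def D_def by (rule has_field_derivative_eval_fps) (rule rad[OF t])
    have ds: "((\<lambda>t. sqrt (1 - t\<^sup>2)) has_field_derivative (- t / s)) (at t within ?I)"
      using t2 by (auto intro!: derivative_eq_intros simp: s_def field_simps)
    have "((\<lambda>t. t / (1 + t)) has_field_derivative (1 / (1 + t)\<^sup>2)) (at t within ?I)"
      using t by (auto intro!: derivative_eq_intros simp: power2_eq_square)
    then have "((\<lambda>t. - (t / (1 + t) * x\<^sup>2)) has_field_derivative - (1 / (1 + t)\<^sup>2 * x\<^sup>2)) (at t within ?I)"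
      by (intro DERIV_minus DERIV_cmult_right)
    from DERIV_chain2[OF DERIV_exp this]
    have de: "((\<lambda>t. exp (- (t / (1 + t) * x\<^sup>2))) has_field_derivative (e * (- x\<^sup>2 / (1 + t)\<^sup>2))) (at t within ?I)"
      by (simp add: e_def)
    have dg: "(g has_field_derivative (D * s * e + F t * (- t / s) * e + F t * s * (e * (- x\<^sup>2 / (1 + t)\<^sup>2)))) (at t within ?I)"
      using DERIV_mult[OF DERIV_mult[OF dF ds] de]
      unfolding g_def s_def[symmetric] e_def[symmetric] by (simp add: algebra_simps)
    have "D * (1 - t\<^sup>2) - t * F t - F t * (1 - t\<^sup>2) * x\<^sup>2 / (1 + t)\<^sup>2 = 0"
    proof -
      have "1 + t \<noteq> 0" "1 - t\<^sup>2 = (1 - t) * (1 + t)" using t by (auto simp: power2_eq_square algebra_simps)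
      have "D * (1 - t\<^sup>2) = (x\<^sup>2 * (1 - t) + t * (1 + t)) * F t / (1 + t)"
        using ode \<open>1 + t \<noteq> 0\<close> by (simp add: field_simps)
      then show ?thesis
        unfolding \<open>1 - t\<^sup>2 = (1 - t) * (1 + t)\<close> using \<open>1 + t \<noteq> 0\<close>
        by (simp add: power2_eq_square) (simp add: field_simps)
    qed
    then have "s * (D * s * e + F t * (- t / s) * e + F t * s * (e * (- x\<^sup>2 / (1 + t)\<^sup>2))) = 0"
    proof -
      have "s * (D * s * e + F t * (- t / s) * e + F t * s * (e * (- x\<^sup>2 / (1 + t)\<^sup>2)))
        = e * (D * (s * s) - t * F t - F t * (s * s) * x\<^sup>2 / (1 + t)\<^sup>2)"
        using s(1) by (simp add: algebra_simps)
      also have "\<dots> = 0" unfolding s(2) \<open>D * (1 - t\<^sup>2) - t * F t - F t * (1 - t\<^sup>2) * x\<^sup>2 / (1 + t)\<^sup>2 = 0\<close> by simp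
      finally show ?thesis .
    qed
    then show ?thesis using dg s(1) by simp
  qed
  then obtain c where c: "\<And>t. t \<in> ?I \<Longrightarrow> g t = c"
    using has_field_derivative_zero_constant[of ?I g] by auto
  have "c = 1" using c[of 0] by (simp add: g_def F_def eval_fps_at_0 hermite_fps_def)
  have r: "r \<in> ?I" using assms by auto
  have "r\<^sup>2 < 1" using assms by (simp add: abs_square_less_1)
  then have "F r = exp (r / (1 + r) * x\<^sup>2) / sqrt (1 - r\<^sup>2)"
    using c[OF r] \<open>c = 1\<close> by (simp add: g_def exp_minus field_simps)
  moreover have "(\<lambda>k. fps_nth (hermite_fps x) k * r ^ k) sums F r"
    unfolding F_def eval_fps_def using rad[OF r] by (intro summable_sums summable_fps) simp
  ultimately show ?thesis by (simp add: hermite_fps_def)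
qed

section \<open>Exponential moments of Gaussian vectors\<close>

text \<open>Completing the square: an exponential weight shifts the mean of a normal density.\<close>

lemma normal_density_exp_tilt:
  assumes "\<sigma> > 0"
  shows "normal_density \<mu> \<sigma> x * exp (c * x) = exp (c * \<mu> + c\<^sup>2 * \<sigma>\<^sup>2 / 2) * normal_density (\<mu> + c * \<sigma>\<^sup>2) \<sigma> x"
proof -
  have "- (x - \<mu>)\<^sup>2 / (2 * \<sigma>\<^sup>2) + c * x
      = (c * \<mu> + c\<^sup>2 * \<sigma>\<^sup>2 / 2) + - (x - (\<mu> + c * \<sigma>\<^sup>2))\<^sup>2 / (2 * \<sigma>\<^sup>2)"
    using assms by (simp add: field_simps power2_eq_square)
  from arg_cong[OF this, of exp] show ?thesis
    by (simp add: normal_density_def exp_add[symmetric] mult.left_commute mult.commute)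
qed

lemma nn_integral_normal_density_exp:
  assumes "\<sigma> > 0"
  shows "(\<integral>\<^sup>+x. ennreal (normal_density \<mu> \<sigma> x * exp (c * x)) \<partial>lborel) = ennreal (exp (c * \<mu> + c\<^sup>2 * \<sigma>\<^sup>2 / 2))"
  unfolding normal_density_exp_tilt[OF assms]
  by (simp add: ennreal_mult nn_integral_cmult nn_integral_normal_density assms)

text \<open>The moment generating function, at \<open>1\<close>, in terms of the second moment: in this form the constant
  and the nondegenerate case of \<^const>\<open>gaussian_rv\<close> share one formula.\<close>

lemma (in prob_space) gaussian_rv_centered:
  assumes Y: "gaussian_rv M Y" and mean: "expectation Y = 0"
  shows gaussian_rv_square_integrable: "integrable M (\<lambda>\<omega>. (Y \<omega>)\<^sup>2)"
    and nn_integral_exp_gaussian_rv: "(\<integral>\<^sup>+\<omega>. ennreal (exp (Y \<omega>)) \<partial>M) = ennreal (exp (expectation (\<lambda>\<omega>. (Y \<omega>)\<^sup>2) / 2))"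
proof -
  have meas [measurable]: "Y \<in> borel_measurable M" using Y by (simp add: gaussian_rv_def)
  consider \<mu> where "AE \<omega> in M. Y \<omega> = \<mu>"
    | \<mu> \<sigma> where "\<sigma> > 0" "distributed M lborel Y (\<lambda>x. ennreal (normal_density \<mu> \<sigma> x))"
    using Y unfolding gaussian_rv_def by blast
  then have "integrable M (\<lambda>\<omega>. (Y \<omega>)\<^sup>2) \<and>
    (\<integral>\<^sup>+\<omega>. ennreal (exp (Y \<omega>)) \<partial>M) = ennreal (exp (expectation (\<lambda>\<omega>. (Y \<omega>)\<^sup>2) / 2))"
  proof cases
    case 1
    have "expectation Y = expectation (\<lambda>_. \<mu>)"
      using 1 by (intro integral_cong_AE) auto
    then have "\<mu> = 0" using mean by (simp add: prob_space)
    then have ae: "AE \<omega> in M. Y \<omega> = 0" using 1 by simp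
    have "integrable M (\<lambda>\<omega>. (Y \<omega>)\<^sup>2)"
      using ae by (subst integrable_cong_AE[where g="\<lambda>_. 0"]) auto
    moreover have "expectation (\<lambda>\<omega>. (Y \<omega>)\<^sup>2) = expectation (\<lambda>_. 0)"
      using ae by (intro integral_cong_AE) auto
    moreover have "(\<integral>\<^sup>+\<omega>. ennreal (exp (Y \<omega>)) \<partial>M) = (\<integral>\<^sup>+\<omega>. 1 \<partial>M)"
      using ae by (intro nn_integral_cong_AE) auto
    ultimately show ?thesis by (simp add: emeasure_space_1)
  next
    case 2
    have "\<mu> = 0" using normal_distributed_expectation[OF 2] mean by simp
    have "variance Y = \<sigma>\<^sup>2" using 2 by (rule normal_distributed_variance)
    then have var: "expectation (\<lambda>\<omega>. (Y \<omega>)\<^sup>2) = \<sigma>\<^sup>2" by (simp add: mean)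
    have "integrable lborel (\<lambda>x. normal_density \<mu> \<sigma> x * x\<^sup>2)"
      using integrable_normal_moment[OF 2(1), of \<mu> 2] by (simp add: \<open>\<mu> = 0\<close>)
    then have "integrable M (\<lambda>\<omega>. (Y \<omega>)\<^sup>2)"
      using distributed_integrable[OF 2(2), of "\<lambda>x. x\<^sup>2"] by simp
    moreover have "(\<integral>\<^sup>+\<omega>. ennreal (exp (Y \<omega>)) \<partial>M)
        = (\<integral>\<^sup>+x. ennreal (normal_density \<mu> \<sigma> x) * ennreal (exp x) \<partial>lborel)"
      by (rule distributed_nn_integral[OF 2(2), symmetric]) simp
    moreover have "\<dots> = ennreal (exp (\<sigma>\<^sup>2 / 2))"
      using nn_integral_normal_density_exp[OF 2(1), of \<mu> 1] by (simp add: ennreal_mult \<open>\<mu> = 0\<close>)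
    ultimately show ?thesis by (simp add: var)
  qed
  then show "integrable M (\<lambda>\<omega>. (Y \<omega>)\<^sup>2)"
    "(\<integral>\<^sup>+\<omega>. ennreal (exp (Y \<omega>)) \<partial>M) = ennreal (exp (expectation (\<lambda>\<omega>. (Y \<omega>)\<^sup>2) / 2))" by auto
qed

lemma centered_gaussian_vector_prob_space: "centered_gaussian_vector M X \<Sigma> \<Longrightarrow> prob_space M"
  by (simp add: centered_gaussian_vector_def gaussian_vector_def)

lemma centered_gaussian_vector_measurable:
  "centered_gaussian_vector M X \<Sigma> \<Longrightarrow> X \<in> borel_measurable M"
  by (simp add: centered_gaussian_vector_def gaussian_vector_def)

lemma nn_integral_exp_gaussian_vector:
  fixes X :: "'a \<Rightarrow> real ^ 'n"
  assumes X: "centered_gaussian_vector M X \<Sigma>"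
  shows "(\<integral>\<^sup>+\<omega>. ennreal (exp (u \<bullet> X \<omega>)) \<partial>M) = ennreal (exp (u \<bullet> (\<Sigma> *v u) / 2))"
proof -
  interpret prob_space M using X by (rule centered_gaussian_vector_prob_space)
  have [measurable]: "X \<in> borel_measurable M" using X by (rule centered_gaussian_vector_measurable)
  have meas [measurable]: "(\<lambda>\<omega>. X \<omega> $ i) \<in> borel_measurable M" for i
    using borel_measurable_inner[of X M "\<lambda>_. axis i 1"] by (simp add: inner_axis)
  have gauss: "gaussian_rv M (\<lambda>\<omega>. v \<bullet> X \<omega>)" for v
    using X by (simp add: centered_gaussian_vector_def gaussian_vector_def)
  have mean: "expectation (\<lambda>\<omega>. X \<omega> $ i) = 0" for i
    using X by (simp add: centered_gaussian_vector_def)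
  have sq: "integrable M (\<lambda>\<omega>. (X \<omega> $ i)\<^sup>2)" for i
    using gaussian_rv_square_integrable[of "\<lambda>\<omega>. X \<omega> $ i"] gauss[of "axis i 1"] mean
    by (simp add: inner_axis')
  have int: "integrable M (\<lambda>\<omega>. X \<omega> $ i)" for i
    by (rule square_integrable_imp_integrable) (auto intro: sq)
  have int2: "integrable M (\<lambda>\<omega>. X \<omega> $ i * X \<omega> $ j)" for i j
  proof (rule Bochner_Integration.integrable_bound)
    show "integrable M (\<lambda>\<omega>. (X \<omega> $ i)\<^sup>2 + (X \<omega> $ j)\<^sup>2)" using sq by auto
    have "\<bar>a * b\<bar> \<le> a\<^sup>2 + b\<^sup>2" for a b :: real
    proof -
      have "2 * (\<bar>a\<bar> * \<bar>b\<bar>) \<le> a\<^sup>2 + b\<^sup>2" using sum_squares_bound[of "\<bar>a\<bar>" "\<bar>b\<bar>"] by simp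
      moreover have "0 \<le> \<bar>a\<bar> * \<bar>b\<bar>" by simp
      ultimately show ?thesis unfolding abs_mult by linarith
    qed
    then show "AE \<omega> in M. norm (X \<omega> $ i * X \<omega> $ j) \<le> norm ((X \<omega> $ i)\<^sup>2 + (X \<omega> $ j)\<^sup>2)"
      by (auto intro!: AE_I2)
  qed simp
  have cov: "expectation (\<lambda>\<omega>. X \<omega> $ i * X \<omega> $ j) = \<Sigma> $ i $ j" for i j
    using X by (auto simp: centered_gaussian_vector_def covariance_matrix_def)
  have "expectation (\<lambda>\<omega>. u \<bullet> X \<omega>) = 0"
    by (simp add: inner_vec_def int mean)
  moreover have "expectation (\<lambda>\<omega>. (u \<bullet> X \<omega>)\<^sup>2) = u \<bullet> (\<Sigma> *v u)"
  proof -
    have "(u \<bullet> X \<omega>)\<^sup>2 = (\<Sum>i\<in>UNIV. \<Sum>j\<in>UNIV. u $ i * u $ j * (X \<omega> $ i * X \<omega> $ j))" for \<omega>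
      by (simp add: inner_vec_def power2_eq_square sum_product algebra_simps)
    then have "expectation (\<lambda>\<omega>. (u \<bullet> X \<omega>)\<^sup>2) = (\<Sum>i\<in>UNIV. \<Sum>j\<in>UNIV. u $ i * u $ j * \<Sigma> $ i $ j)"
      by (simp add: int2 cov)
    also have "\<dots> = u \<bullet> (\<Sigma> *v u)"
      by (simp add: inner_vec_def matrix_vector_mult_def sum_distrib_left algebra_simps)
    finally show ?thesis .
  qed
  ultimately show ?thesis
    using nn_integral_exp_gaussian_rv[OF gauss] by simp
qed

text \<open>The Hubbard-Stratonovich trick. Each factor \<open>exp ((s x)\<^sup>2 / 2)\<close> is the integral of \<open>exp (s x y)\<close>
  against the standard normal density in an auxiliary variable \<open>y\<close>. After exchanging the integrals,
  the expectation over \<open>X\<close> is a moment generating function, and what is left is the Gaussian integral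
  of the matrix \<open>B\<close> over the auxiliary variables. Only the laws of the linear combinations
  of \<open>X\<close> enter, and these are what the definition of a Gaussian vector provides.\<close>

lemma nn_integral_exp_diagonal_quadratic_form:
  fixes X :: "'a \<Rightarrow> real ^ 'n" and B :: "real ^ 'n ^ 'n"
  assumes X: "centered_gaussian_vector M X \<Sigma>"
    and B: "B = mat 1 - (\<chi> i j. s i * \<Sigma> $ i $ j * s j)" and pd: "pos_def B"
  shows "(\<integral>\<^sup>+\<omega>. ennreal (\<Prod>i\<in>UNIV. exp ((s i * X \<omega> $ i)\<^sup>2 / 2)) \<partial>M) = ennreal (1 / sqrt (det B))"
proof -
  interpret prob_space M using X by (rule centered_gaussian_vector_prob_space)
  have [measurable]: "X \<in> borel_measurable M" using X by (rule centered_gaussian_vector_measurable)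
  interpret pair_sigma_finite M "lborel :: (real ^ 'n) measure" ..
  define \<phi> where "\<phi> y = (\<Prod>i\<in>UNIV. std_normal_density (y $ i))" for y :: "real ^ 'n"
  have \<phi>: "\<phi> y = (1 / sqrt (2 * pi)) ^ CARD('n) * exp (- (y \<bullet> y) / 2)" for y
    unfolding \<phi>_def by (rule prod_std_normal_density)
  have \<phi>_nonneg: "\<phi> y \<ge> 0" for y by (simp add: \<phi>_def prod_nonneg)
  have [measurable]: "\<phi> \<in> borel_measurable borel" unfolding \<phi> by measurable
  define sy where "sy y = (\<chi> i. s i * y $ i)" for y :: "real ^ 'n"
  have [measurable]: "sy \<in> borel \<rightarrow>\<^sub>M borel"
    unfolding sy_def by (intro borel_measurable_continuous_onI continuous_intros)
  have linearize: "ennreal (\<Prod>i\<in>UNIV. exp ((s i * x $ i)\<^sup>2 / 2)) = (\<integral>\<^sup>+y. ennreal (\<phi> y * exp (sy y \<bullet> x)) \<partial>lborel)" for x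
  proof -
    \<comment> \<open>the one-dimensional factors, indexed by basis vectors as the product formula for \<open>lborel\<close> asks\<close>
    define f where "f b y = ennreal (std_normal_density y * exp (s (SOME i. b = axis i 1) * (x \<bullet> b) * y))" for b :: "real ^ 'n" and y
    have f: "f (axis i 1) = (\<lambda>y. ennreal (std_normal_density y * exp (s i * x $ i * y)))" for i
      by (simp add: f_def axis_eq_axis inner_axis fun_eq_iff)
    have integrand: "(\<Prod>b\<in>Basis. f b (y \<bullet> b)) = ennreal (\<phi> y * exp (sy y \<bullet> x))" for y
    proof -
      have "(\<Prod>b\<in>Basis. f b (y \<bullet> b)) = ennreal (\<phi> y * (\<Prod>i\<in>UNIV. exp (s i * x $ i * y $ i)))"
        by (simp add: prod_Basis_cart f inner_axis prod_ennreal prod.distrib \<phi>_def)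
      also have "(\<Prod>i\<in>UNIV. exp (s i * x $ i * y $ i)) = exp (sy y \<bullet> x)"
        by (simp add: exp_sum[symmetric] inner_vec_def sy_def algebra_simps)
      finally show ?thesis .
    qed
    have "ennreal (\<Prod>i\<in>UNIV. exp ((s i * x $ i)\<^sup>2 / 2)) = (\<Prod>b\<in>Basis. (\<integral>\<^sup>+y. f b y \<partial>lborel))"
      using nn_integral_normal_density_exp[of 1 0]
      by (simp add: prod_Basis_cart f prod_ennreal)
    also have "\<dots> = (\<integral>\<^sup>+y. (\<Prod>b\<in>Basis. f b (y \<bullet> b)) \<partial>lborel)"
      by (rule nn_integral_lborel_prod[symmetric]) (auto simp: f_def)
    also have "\<dots> = (\<integral>\<^sup>+y. ennreal (\<phi> y * exp (sy y \<bullet> x)) \<partial>lborel)"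
      by (simp only: integrand)
    finally show ?thesis .
  qed
  have quad: "sy y \<bullet> (\<Sigma> *v sy y) - y \<bullet> y = - (y \<bullet> (B *v y))" for y
  proof -
    have "sy y \<bullet> (\<Sigma> *v sy y) = y \<bullet> ((\<chi> i j. s i * \<Sigma> $ i $ j * s j) *v y)"
      by (simp add: inner_vec_def matrix_vector_mult_def sy_def sum_distrib_left algebra_simps)
    then show ?thesis by (simp add: B matrix_vector_mult_diff_rdistrib inner_diff_right)
  qed
  have "(\<integral>\<^sup>+\<omega>. ennreal (\<Prod>i\<in>UNIV. exp ((s i * X \<omega> $ i)\<^sup>2 / 2)) \<partial>M)
      = (\<integral>\<^sup>+\<omega>. (\<integral>\<^sup>+y. ennreal (\<phi> y * exp (sy y \<bullet> X \<omega>)) \<partial>lborel) \<partial>M)"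
    by (simp add: linearize)
  also have "\<dots> = (\<integral>\<^sup>+y. (\<integral>\<^sup>+\<omega>. ennreal (\<phi> y * exp (sy y \<bullet> X \<omega>)) \<partial>M) \<partial>lborel)"
    by (rule Fubini'[symmetric]) measurable
  also have "\<dots> = (\<integral>\<^sup>+y. ennreal (\<phi> y * exp (sy y \<bullet> (\<Sigma> *v sy y) / 2)) \<partial>lborel)"
    using nn_integral_exp_gaussian_vector[OF X]
    by (simp add: ennreal_mult \<phi>_nonneg nn_integral_cmult)
  also have "\<dots> = (\<integral>\<^sup>+y. ennreal ((1 / sqrt (2 * pi)) ^ CARD('n) * exp (- (y \<bullet> (B *v y)) / 2)) \<partial>lborel)"
  proof (intro nn_integral_cong arg_cong[of _ _ ennreal])
    fix y
    have "\<phi> y * exp (sy y \<bullet> (\<Sigma> *v sy y) / 2)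
        = (1 / sqrt (2 * pi)) ^ CARD('n) * exp (- (y \<bullet> y) / 2 + sy y \<bullet> (\<Sigma> *v sy y) / 2)"
      unfolding \<phi> exp_add by (simp only: mult.assoc)
    also have "- (y \<bullet> y) / 2 + sy y \<bullet> (\<Sigma> *v sy y) / 2 = - (y \<bullet> (B *v y)) / 2"
      using quad[of y] by simp
    finally show "\<phi> y * exp (sy y \<bullet> (\<Sigma> *v sy y) / 2)
        = (1 / sqrt (2 * pi)) ^ CARD('n) * exp (- (y \<bullet> (B *v y)) / 2)" .
  qed
  also have "\<dots> = ennreal (1 / sqrt (det B))" by (rule nn_integral_gaussian[OF pd])
  finally show ?thesis .
qed

section \<open>The determinant as a Hermite series\<close>

text \<open>Tonelli for a countable family: a finite total integral alone gives integrability of each term,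
  summability and the value of the sum.\<close>

lemma integral_swap_nonneg_infsum:
  fixes f :: "'i \<Rightarrow> 'a \<Rightarrow> real"
  assumes I: "countable (UNIV :: 'i set)"
    and meas [measurable]: "\<And>k. f k \<in> borel_measurable M"
    and nonneg: "\<And>k \<omega>. f k \<omega> \<ge> 0"
    and total: "(\<integral>\<^sup>+\<omega>. (\<integral>\<^sup>+k. ennreal (f k \<omega>) \<partial>count_space UNIV) \<partial>M) = ennreal c" "c \<ge> 0"
  shows "integrable M (f k)"
    and "(\<lambda>k. \<integral>\<omega>. f k \<omega> \<partial>M) summable_on UNIV"
    and "(\<Sum>\<^sub>\<infinity>k\<in>UNIV. \<integral>\<omega>. f k \<omega> \<partial>M) = c"
proof -
  have swap: "(\<integral>\<^sup>+k. (\<integral>\<^sup>+\<omega>. ennreal (f k \<omega>) \<partial>M) \<partial>count_space UNIV) = ennreal c"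
    using nn_integral_count_space_nn_integral[OF I, of "\<lambda>k \<omega>. ennreal (f k \<omega>)" M] total(1) by simp
  have int: "integrable M (f k)" for k
  proof -
    have "(\<integral>\<^sup>+\<omega>. ennreal (f k \<omega>) \<partial>M) \<le> ennreal c"
      unfolding swap[symmetric] by (rule nn_integral_ge_point) simp
    then show ?thesis
      by (intro integrableI_nonneg) (auto simp: nonneg le_less_trans)
  qed
  then show "integrable M (f k)" .
  have eq: "(\<integral>\<^sup>+\<omega>. ennreal (f k \<omega>) \<partial>M) = ennreal (\<integral>\<omega>. f k \<omega> \<partial>M)" for k
    using int nonneg by (intro nn_integral_eq_integral) auto
  let ?g = "\<lambda>k. \<integral>\<omega>. f k \<omega> \<partial>M"
  have g: "?g k \<ge> 0" for k using nonneg by (intro integral_nonneg_AE) auto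
  have sum: "(\<integral>\<^sup>+k. ennreal (?g k) \<partial>count_space UNIV) = ennreal c"
    using swap by (simp add: eq)
  then have abs: "Infinite_Set_Sum.abs_summable_on ?g UNIV"
    unfolding Infinite_Set_Sum.abs_summable_on_def using g by (intro integrableI_nonneg) auto
  then show "?g summable_on UNIV"
    by (meson abs_summable_equivalent abs_summable_summable)
  have "ennreal (infsum ?g UNIV) = ennreal c"
    using nn_integral_conv_infsetsum[OF abs g] infsetsum_infsum[OF abs] sum by simp
  moreover have "infsum ?g UNIV \<ge> 0" by (intro infsum_nonneg g)
  ultimately show "infsum ?g UNIV = c" using total(2) by simp
qed

text \<open>A product of series, expanded over multi-indices.\<close>

lemma nn_integral_count_space_prod_sums:
  fixes a :: "'n::finite \<Rightarrow> nat \<Rightarrow> real"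
  assumes nonneg: "\<And>i k. a i k \<ge> 0" and sums: "\<And>i. a i sums s i"
  shows "(\<integral>\<^sup>+k. ennreal (\<Prod>i\<in>UNIV. a i (k i)) \<partial>count_space UNIV) = ennreal (\<Prod>i\<in>UNIV. s i)"
proof -
  have abs: "Infinite_Set_Sum.abs_summable_on (a i) UNIV" for i
    using sums[of i] nonneg by (simp add: abs_summable_on_nat_iff' sums_iff)
  have s: "infsetsum (a i) UNIV = s i" for i
    using abs sums[of i] by (simp add: infsetsum_nat' sums_iff)
  have U: "PiE (UNIV :: 'n set) (\<lambda>_. UNIV :: nat set) = UNIV" by (simp add: PiE_UNIV_domain)
  have "Infinite_Set_Sum.abs_summable_on (\<lambda>k. \<Prod>i\<in>UNIV. a i (k i)) UNIV"
    using abs_summable_on_prod_PiE[of "UNIV :: 'n set" "\<lambda>_. UNIV" a] abs U by simp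
  then show ?thesis
    using nn_integral_conv_infsetsum[of "\<lambda>k. \<Prod>i\<in>UNIV. a i (k i)" UNIV]
      infsetsum_prod_PiE[of "UNIV :: 'n set" "\<lambda>_. UNIV" a] abs U
    by (simp add: nonneg prod_nonneg s)
qed

theorem theorem4p1:
  fixes S Z \<Sigma> :: "real ^ 'n ^ 'n"
  assumes S: "pos_def S"
    and Z: "Z = diag_part S"
    and Z_less: "Z \<prec> mat 1"
    and ZS_less: "Z + S \<prec> 2 *\<^sub>R mat 1"
    and \<Sigma>: "\<Sigma> = mat 1 - (1 / 2) *\<^sub>R (mat_inv_sqrt (mat 1 - Z) ** (S - Z) ** mat_inv_sqrt (mat 1 - Z))"
  shows "transpose \<Sigma> = \<Sigma> \<and> pos_def \<Sigma> \<and> (\<forall>i. \<Sigma> $ i $ i = 1) \<and>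
    (\<forall>(M :: 'a measure) X. centered_gaussian_vector M X \<Sigma> \<longrightarrow>
       (\<forall>k. integrable M (\<lambda>\<omega>. \<Prod>i\<in>UNIV. (poly (Hermite (k i)) (X \<omega> $ i))\<^sup>2)) \<and>
       hermite_term M X S summable_on UNIV \<and>
       det S = (\<Sum>\<^sub>\<infinity>k\<in>UNIV. hermite_term M X S k) powi (-2)) \<and>
    det S \<le> (\<Prod>i\<in>UNIV. S $ i $ i) \<and>
    (\<forall>A :: real ^ 'n ^ 'n. pos_def A \<longrightarrow> det A \<le> (\<Prod>i\<in>UNIV. A $ i $ i))"
proof -
  define z where "z i = S $ i $ i" for i
  define r where "r i = 1 - z i" for i
  have z: "z i > 0" for i using pos_def_diag_entry[OF S] by (simp add: z_def)
  have R: "mat 1 - Z = diag_matrix r"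
    by (auto simp: vec_eq_iff Z diag_part_def diag_matrix_def mat_def r_def z_def)
  have r: "r i > 0" for i
    using pos_def_diag_entry[of "mat 1 - Z" i] Z_less by (simp add: mat_less_def R diag_matrix_def)
  have r1: "r i < 1" for i using z[of i] by (simp add: r_def)
  have \<Sigma>_entry: "\<Sigma> $ i $ j = (if i = j then 1 else - (S $ i $ j) / (2 * (sqrt (r i) * sqrt (r j))))" for i j
  proof -
    have "\<Sigma> = mat 1 - (1 / 2) *\<^sub>R (\<chi> i j. 1 / sqrt (r i) * (S - Z) $ i $ j * (1 / sqrt (r j)))"
      unfolding \<Sigma> R mat_inv_sqrt_diag_matrix[of r, OF r] diag_matrix_congruence ..
    then show ?thesis by (simp add: mat_def Z diag_part_def)
  qed
  \<comment> \<open>\<open>\<Sigma>\<close> is congruent to \<open>2 I - Z - S\<close>, which is positive definite because \<open>Z + S \<prec> 2 I\<close>\<close>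
  have \<Sigma>_congruence: "\<Sigma> = (\<chi> i j. (1 / sqrt (2 * r i)) * (2 *\<^sub>R mat 1 - (Z + S)) $ i $ j * (1 / sqrt (2 * r j)))"
  proof -
    have "(1 / sqrt (2 * r i)) * (2 *\<^sub>R mat 1 - (Z + S)) $ i $ j * (1 / sqrt (2 * r j)) = \<Sigma> $ i $ j" for i j
    proof (cases "i = j")
      case True
      have "sqrt (r i) * sqrt (r i) = r i" using r[of i] by simp
      with True r[of i] show ?thesis
        by (simp add: \<Sigma>_entry mat_def Z diag_part_def z_def[symmetric] real_sqrt_mult)
          (simp add: r_def field_simps)
    next
      case False
      then show ?thesis by (simp add: \<Sigma>_entry mat_def Z diag_part_def real_sqrt_mult)
    qed
    then show ?thesis by (simp add: vec_eq_iff)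
  qed
  have pd\<Sigma>: "pos_def \<Sigma>"
  proof -
    have "1 / sqrt (2 * r i) \<noteq> 0" for i using r[of i] by simp
    then show ?thesis
      using ZS_less unfolding mat_less_def \<Sigma>_congruence by (rule pos_def_diagonal_congruence[rotated])
  qed
  have series: "(\<forall>k. integrable M (\<lambda>\<omega>. \<Prod>i\<in>UNIV. (poly (Hermite (k i)) (X \<omega> $ i))\<^sup>2)) \<and>
       hermite_term M X S summable_on UNIV \<and>
       det S = (\<Sum>\<^sub>\<infinity>k\<in>UNIV. hermite_term M X S k) powi (-2)"
    if X: "centered_gaussian_vector M X \<Sigma>" for M :: "'a measure" and X
  proof -
    \<comment> \<open>Mehler's formula at \<open>r i\<close> has the exponent \<open>r i / (1 + r i) x\<^sup>2\<close>, which is \<open>(s i x)\<^sup>2 / 2\<close>; its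
      prefactor times \<open>sqrt (S i i)\<close> is \<open>w i\<close>, because \<open>1 - (r i)\<^sup>2 = S i i * (1 + r i)\<close>\<close>
    define s where "s i = sqrt (2 * r i / (1 + r i))" for i
    define w where "w i = 1 / sqrt (1 + r i)" for i
    have w: "w i > 0" for i using r[of i] by (simp add: w_def)
    have w_prod: "(\<Prod>i\<in>UNIV. w i) > 0" using w by (intro prod_pos) auto
    define B where "B = mat 1 - (\<chi> i j. s i * \<Sigma> $ i $ j * s j)"
    \<comment> \<open>the matrix left by the linearization is congruent to \<open>S\<close> itself, so it inherits positivity and
      its determinant is \<open>det S\<close> up to the weights\<close>
    have B: "B = (\<chi> i j. w i * S $ i $ j * w j)"
    proof -
      have "B $ i $ j = w i * S $ i $ j * w j" for i j
      proof (cases "i = j")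
        case True
        have "s i * s i = 2 * r i / (1 + r i)" "w i * w i = 1 / (1 + r i)"
          using r[of i] by (simp_all add: s_def w_def)
        moreover have "w i * S $ i $ i * w i = (w i * w i) * z i" by (simp add: z_def)
        ultimately show ?thesis
          using True r[of i] by (simp add: B_def mat_def \<Sigma>_entry) (simp add: r_def field_simps)
      next
        case False
        have "s i * s j = 2 * (sqrt (r i) * sqrt (r j)) * (w i * w j)"
          by (simp add: s_def w_def real_sqrt_mult real_sqrt_divide)
        moreover have "sqrt (r i) * sqrt (r j) \<noteq> 0" using r[of i] r[of j] by simp
        moreover have "B $ i $ j = (s i * s j) * S $ i $ j / (2 * (sqrt (r i) * sqrt (r j)))"
          using False by (simp add: B_def mat_def \<Sigma>_entry mult_ac)
        ultimately have "B $ i $ j = w i * w j * S $ i $ j" by simp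
        then show ?thesis by (simp only: mult_ac)
      qed
      then show ?thesis by (simp add: vec_eq_iff)
    qed
    have pdB: "pos_def B"
      unfolding B using w by (intro pos_def_diagonal_congruence S) (metis less_irrefl)
    have detB: "det B = (\<Prod>i\<in>UNIV. w i)\<^sup>2 * det S" unfolding B by (rule det_diagonal_congruence)
    have [measurable]: "X \<in> borel_measurable M" using X by (rule centered_gaussian_vector_measurable)
    have [measurable]: "(\<lambda>\<omega>. X \<omega> $ i) \<in> borel_measurable M" for i
      using borel_measurable_inner[of X M "\<lambda>_. axis i 1"] by (simp add: inner_axis)
    have poly_meas [measurable]: "poly p \<in> borel_measurable borel" for p :: "real poly"
      by (intro borel_measurable_continuous_onI continuous_intros)
    define a where "a i k x = (poly (Hermite k) x)\<^sup>2 / fact k * (sqrt (z i) * r i ^ k)" for i k x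
    have a_nonneg: "a i k x \<ge> 0" for i k x using z[of i] r[of i] by (simp add: a_def)
    have [measurable]: "a i k \<in> borel_measurable borel" for i k unfolding a_def by measurable
    have a_sums: "(\<lambda>k. a i k x) sums (w i * exp ((s i * x)\<^sup>2 / 2))" for i x
    proof -
      have "(\<lambda>k. (poly (Hermite k) x)\<^sup>2 / fact k * r i ^ k) sums (exp (r i / (1 + r i) * x\<^sup>2) / sqrt (1 - (r i)\<^sup>2))"
        using r[of i] r1[of i] by (intro Mehler_diagonal) simp
      from sums_mult[OF this, of "sqrt (z i)"]
      have "(\<lambda>k. a i k x) sums (sqrt (z i) * (exp (r i / (1 + r i) * x\<^sup>2) / sqrt (1 - (r i)\<^sup>2)))"
        by (simp add: a_def mult_ac)
      moreover have "sqrt (z i) / sqrt (1 - (r i)\<^sup>2) = w i"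
      proof -
        have "1 - (r i)\<^sup>2 = z i * (1 + r i)" by (simp add: r_def power2_eq_square algebra_simps)
        then show ?thesis using z[of i] by (simp add: w_def real_sqrt_mult)
      qed
      moreover have "r i / (1 + r i) * x\<^sup>2 = (s i * x)\<^sup>2 / 2"
      proof -
        have "(s i)\<^sup>2 = 2 * (r i / (1 + r i))" using r[of i] by (simp add: s_def)
        moreover have "2 * q * x\<^sup>2 / 2 = q * x\<^sup>2" for q by simp
        ultimately show ?thesis by (simp only: power_mult_distrib)
      qed
      ultimately show ?thesis
        by (simp only: times_divide_eq_right times_divide_eq_left[symmetric])
    qed
    define f where "f k \<omega> = (\<Prod>i\<in>UNIV. a i (k i) (X \<omega> $ i))" for k \<omega>
    have total: "(\<integral>\<^sup>+\<omega>. (\<integral>\<^sup>+k. ennreal (f k \<omega>) \<partial>count_space UNIV) \<partial>M) = ennreal (1 / sqrt (det S))"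
    proof -
      have "(\<integral>\<^sup>+k. ennreal (f k \<omega>) \<partial>count_space UNIV)
          = ennreal (\<Prod>i\<in>UNIV. w i) * ennreal (\<Prod>i\<in>UNIV. exp ((s i * X \<omega> $ i)\<^sup>2 / 2))" for \<omega>
        unfolding f_def using less_imp_le[OF w_prod]
        by (subst nn_integral_count_space_prod_sums[OF a_nonneg a_sums])
           (simp add: prod.distrib ennreal_mult')
      then have "(\<integral>\<^sup>+\<omega>. (\<integral>\<^sup>+k. ennreal (f k \<omega>) \<partial>count_space UNIV) \<partial>M)
          = ennreal (\<Prod>i\<in>UNIV. w i) * ennreal (1 / sqrt (det B))"
        using nn_integral_exp_diagonal_quadratic_form[OF X B_def pdB] by (simp add: nn_integral_cmult)
      also have "\<dots> = ennreal (1 / sqrt (det S))"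
        using det_pos_of_pos_def[OF S] w_prod
        by (subst ennreal_mult'[symmetric]) (auto simp: detB real_sqrt_mult simp del: prod_zero_iff)
      finally show ?thesis .
    qed
    have fin: "countable (UNIV :: ('n \<Rightarrow> nat) set)" by simp
    have [measurable]: "f k \<in> borel_measurable M" for k unfolding f_def by measurable
    have f_nonneg: "f k \<omega> \<ge> 0" for k \<omega> unfolding f_def by (intro prod_nonneg) (auto simp: a_nonneg)
    have "0 \<le> 1 / sqrt (det S)" using det_pos_of_pos_def[OF S] by simp
    note swap = integral_swap_nonneg_infsum[OF fin _ f_nonneg total this, simplified]
    have nz: "z i \<noteq> 0" "r i \<noteq> 0" for i using z[of i] r[of i] by simp_all
    have f_eq: "f k \<omega> = (\<Prod>i\<in>UNIV. sqrt (z i) * r i ^ k i / fact (k i)) * (\<Prod>i\<in>UNIV. (poly (Hermite (k i)) (X \<omega> $ i))\<^sup>2)" for k \<omega>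
      unfolding f_def a_def prod.distrib[symmetric] by (simp add: mult_ac)
    have int: "integrable M (\<lambda>\<omega>. \<Prod>i\<in>UNIV. (poly (Hermite (k i)) (X \<omega> $ i))\<^sup>2)" for k
      using swap(1)[of k] unfolding f_eq by (simp add: nz)
    have term_eq: "hermite_term M X S = (\<lambda>k. \<integral>\<omega>. f k \<omega> \<partial>M)"
      unfolding f_eq by (simp add: fun_eq_iff hermite_term_def z_def[symmetric] r_def[symmetric] prod_dividef)
    \<comment> \<open>the sum of the series is \<open>1 / sqrt (det S)\<close>\<close>
    have "det S = (1 / sqrt (det S)) powi (-2)"
      using det_pos_of_pos_def[OF S] by (simp add: power_int_minus power_divide)
    then show ?thesis
      using int swap(2,3) unfolding term_eq by simp
  qed
  show ?thesis
    using pd\<Sigma> series Hadamard_inequality S by (auto simp: \<Sigma>_entry pos_def_def[of \<Sigma>])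
qed

end
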